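(* Assume the setting in the context. Then for every $\lambda\in\mathbb{R}^d$, for $\mathbb{P}$-almost every $\omega$, $$\limsup_{n\to\infty}\frac1n\log E^{P_\omega}\left[\mathrm{e}^{\langle\lambda,X_n\rangle}\right]\le\Lambda(\lambda).$$
   Context: Let $d\ge 1$ and $U=\{e\in\mathbb{Z}^d: |e|=1\}$ ($\ell_1$ norm $|x|=\sum|x_i|$). Let $(\Omega,\mathcal{F},\mathbb{P})$ be a probability space and $\{T_e\}_{e\in U}$ commuting $\mathbb{P}$-measure-preserving transformations with $T_{-e}=T_e^{-1}$, forming an ergodic family (every event invariant under all $T_e$ has probability $0$ or $1$); $T_x=T_{e_1}^{x_1}\cdots T_{e_d}^{x_d}$. Let $p:\Omega\times U\to[0,1]$ be measurable with $\sum_{e}p(\omega,e)=1$. For fixed $\omega$, $P_\omega$ is the law of the random walk $(X_n)$ on $\mathbb{Z}^d$ with $X_0=0$ and $P_\omega(X_{n+1}=X_n+e\mid X_0,\dots,X_n)=p(T_{X_n}\omega,e)$. A function $F:\Omega\times U\to\mathbb{R}$ is in class $\mathcal{K}$ if: (i) there is $\alpha>0$ with $\mathbb{E}[|F(\cdot,e)|^{d+\alpha}]<\infty$ for every $e$; (ii) $\mathbb{E}[F(\cdot,e)]=0$ for every $e$; (iii) ($\mathbb{P}$-a.s.) for every finite sequence $x_0,\dots,x_n\in\mathbb{Z}^d$ with $x_{i+1}-x_i\in U$ and $x_0=x_n$, $\sum_{i=0}^{n-1}F(T_{x_i}\omega,x_{i+1}-x_i)=0$. $$\Lambda(\lambda)=\inf_{F\in\mathcal{K}}\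 \operatorname*{ess\,sup}_{\omega}\ \log\sum_{e\in U}p(\omega,e)\,\mathrm{e}^{\langle\lambda,e\rangle+F(\omega,e)}.$$ *)

theory Defs
  imports "HOL-Probability.Probability"
begin

definition l1norm :: "int^'d::finite \<Rightarrow> int" where
  "l1norm x = (\<Sum>i\<in>UNIV. \<bar>x $ i\<bar>)"

definition nbrs :: "(int^'d::finite) set" where
  "nbrs = {e. l1norm e = 1}"

definition linner :: "real^'d::finite \<Rightarrow> int^'d \<Rightarrow> real" where
  "linner lam x = (\<Sum>i\<in>UNIV. lam $ i * real_of_int (x $ i))"

text \<open>Integer powers T_e^k, using T_{-e} = T_e^{-1}.\<close>
definition Upow :: "(int^'d::finite \<Rightarrow> 'w \<Rightarrow> 'w) \<Rightarrow> int^'d \<Rightarrow> int \<Rightarrow> 'w \<Rightarrow> 'w" where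
  "Upow T e k = (if 0 \<le> k then T e ^^ nat k else T (- e) ^^ nat (- k))"

text \<open>T_x = T_{e_1}^{x_1} o ... o T_{e_d}^{x_d} (order irrelevant since the T_e commute).\<close>
definition Tshift :: "(int^'d::finite \<Rightarrow> 'w \<Rightarrow> 'w) \<Rightarrow> int^'d \<Rightarrow> 'w \<Rightarrow> 'w" where
  "Tshift T x = foldr (\<lambda>i f. Upow T (axis i 1) (x $ i) \<circ> f)
      (SOME l. distinct l \<and> set l = (UNIV :: 'd set)) id"

definition walkpos :: "(int^'d::finite) list \<Rightarrow> nat \<Rightarrow> int^'d" where
  "walkpos es k = sum_list (take k es)"

text \<open>E^{P_omega}[exp <lam, X_n>], written out as the finite sum over all n-step paths
  of the path probability times exp <lam, X_n>.\<close>
definition walk_mgf ::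
  "(int^'d::finite \<Rightarrow> 'w \<Rightarrow> 'w) \<Rightarrow> ('w \<Rightarrow> int^'d \<Rightarrow> real) \<Rightarrow> real^'d \<Rightarrow> nat \<Rightarrow> 'w \<Rightarrow> real" where
  "walk_mgf T p lam n \<omega> =
     (\<Sum>es\<in>{es. set es \<subseteq> nbrs \<and> length es = n}.
        (\<Prod>i<n. p (Tshift T (walkpos es i) \<omega>) (es ! i)) * exp (linner lam (walkpos es n)))"

definition classK ::
  "'w measure \<Rightarrow> (int^'d::finite \<Rightarrow> 'w \<Rightarrow> 'w) \<Rightarrow> ('w \<Rightarrow> int^'d \<Rightarrow> real) set" where
  "classK M T = {F.
     (\<forall>e\<in>nbrs. (\<lambda>\<omega>. F \<omega> e) \<in> borel_measurable M) \<and>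
     (\<exists>\<alpha>>0. \<forall>e\<in>nbrs. integrable M (\<lambda>\<omega>. \<bar>F \<omega> e\<bar> powr (real CARD('d) + \<alpha>))) \<and>
     (\<forall>e\<in>nbrs. (\<integral>\<omega>. F \<omega> e \<partial>M) = 0) \<and>
     (AE \<omega> in M. \<forall>xs::(int^'d) list. \<forall>n.
        length xs = Suc n \<and> xs ! 0 = xs ! n \<and> (\<forall>i<n. xs ! Suc i - xs ! i \<in> nbrs) \<longrightarrow>
        (\<Sum>i<n. F (Tshift T (xs ! i) \<omega>) (xs ! Suc i - xs ! i)) = 0)}"

definition LambdaK ::
  "'w measure \<Rightarrow> (int^'d::finite \<Rightarrow> 'w \<Rightarrow> 'w) \<Rightarrow> ('w \<Rightarrow> int^'d \<Rightarrow> real) \<Rightarrow> real^'d \<Rightarrow> ereal" where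
  "LambdaK M T p lam = (INF F\<in>classK M T. esssup M (\<lambda>\<omega>.
      ereal (ln (\<Sum>e\<in>nbrs. p \<omega> e * exp (linner lam e + F \<omega> e)))))"

end

(*
Fix F in the class K. Summing F along lattice paths gives a corrector f with f(0) = 0 and increments
F; weighting paths by exp(f(X_n)) turns the moment generating function into a sum that grows by at
most the factor exp(esssup ...) per step, so it only remains to show max_{|x| <= n} |f(x)| = o(n).

For a fixed direction z, the sequence f(n z) is a Birkhoff sum with mean 0. Its upper slope is
invariant under all shifts, because F(T_{nz} omega, e) = o(n), hence constant by ergodicity, and
Garsia's maximal ergodic inequality shows that the constant is at most 0. The same holds for -F.

Uniformity over directions comes from integrability of |F|^q for some q > d: a Vitali covering
argument bounds the averages of |F|^q over all cubes around 0 almost surely, and a discrete Morrey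
inequality on dyadic cubes turns this into Hoelder equicontinuity of the rescaled correctors, so
finitely many directions suffice.
*)
theory Submission
  imports Defs
begin

section \<open>Measure-preserving lattice actions\<close>

text \<open>Only the whole family of shifts is ergodic; a single \<open>Tshift T z\<close> may have
  nontrivial invariant events. Birkhoff's theorem in the direction \<open>z\<close> would therefore
  give only a possibly random limit, and the other directions must force it to be constant. Here
  closedness of \<open>F\<close> does more than define f: moving the base point by a neighbour e
  changes f(n z) by just two values of \<open>F\<close>, so the slope does not see the base point.
  The condition q > d enters twice through d/q < 1: a single value of \<open>F\<close> within
  distance n is of order at most n^(d/q), and \<rho> = 2^(d/q - 1) < 1 is the ratio of the geometric
  series over dyadic scales. Both uses ask only that the spatial averages of |F|^q stay bounded, so
  a weak-type maximal inequality takes the place of a multiparameter ergodic theorem. Null sets need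
  care in two places: the one-step bound must hold at all sites of an orbit at once, which
  countability of the lattice permits, and the infimum over the uncountable class is approached
  along a sequence.\<close>

lemma nbrs_eq: "nbrs = range (\<lambda>i. axis i 1) \<union> range (\<lambda>i. - axis i (1::int))"
proof (intro set_eqI iffI)
  fix e :: "int^'d"
  assume "e \<in> nbrs"
  then have s: "(\<Sum>i\<in>UNIV. \<bar>e $ i\<bar>) = 1"
    by (simp add: nbrs_def l1norm_def)
  then obtain i where i: "e $ i \<noteq> 0"
    by (metis abs_zero sum.neutral zero_neq_one)
  have "(\<Sum>i\<in>UNIV. \<bar>e $ i\<bar>) = \<bar>e $ i\<bar> + (\<Sum>j\<in>UNIV - {i}. \<bar>e $ j\<bar>)"
    by (simp add: sum.remove)
  moreover have "(\<Sum>j\<in>UNIV - {i}. \<bar>e $ j\<bar>) \<ge> 0"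
    by (simp add: sum_nonneg)
  ultimately have "\<bar>e $ i\<bar> = 1" and "(\<Sum>j\<in>UNIV - {i}. \<bar>e $ j\<bar>) = 0"
    using s i by linarith+
  then have "e $ j = 0" if "j \<noteq> i" for j
    using that by (simp add: sum_nonneg_eq_0_iff)
  moreover have "e $ i = 1 \<or> e $ i = -1"
    using \<open>\<bar>e $ i\<bar> = 1\<close> by linarith
  ultimately have "e = axis i 1 \<or> e = - axis i 1"
    by (auto simp: vec_eq_iff axis_def)
  then show "e \<in> range (\<lambda>i. axis i 1) \<union> range (\<lambda>i. - axis i 1)"
    by blast
next
  fix e :: "int^'d"
  have "l1norm (axis i 1 :: int^'d) = 1" for i
    by (simp add: l1norm_def axis_def if_distrib cong: if_cong)
  moreover have "l1norm (- axis i 1 :: int^'d) = 1" for i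
    by (simp add: l1norm_def axis_def if_distrib cong: if_cong)
  moreover assume "e \<in> range (\<lambda>i. axis i 1) \<union> range (\<lambda>i. - axis i 1)"
  ultimately show "e \<in> nbrs"
    by (auto simp: nbrs_def)
qed

lemma axis_in_nbrs [simp, intro]: "axis i 1 \<in> nbrs"
  by (auto simp: nbrs_eq)

lemma uminus_nbrs [simp]: "- e \<in> nbrs \<longleftrightarrow> e \<in> nbrs"
  by (simp add: nbrs_def l1norm_def)

lemma finite_nbrs [simp, intro]: "finite nbrs"
  by (simp add: nbrs_eq)

lemma nbrs_nonempty: "nbrs \<noteq> {}"
  by (auto simp: nbrs_eq)

locale lattice_action = prob_space M
  for M :: "'w measure" +
  fixes T :: "int^'d::finite \<Rightarrow> 'w \<Rightarrow> 'w"
  assumes T_meas: "\<And>e. e \<in> nbrs \<Longrightarrow> T e \<in> M \<rightarrow>\<^sub>M M"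
    and T_pres: "\<And>e. e \<in> nbrs \<Longrightarrow> distr M M (T e) = M"
    and T_comm: "\<And>e e' \<omega>. e \<in> nbrs \<Longrightarrow> e' \<in> nbrs \<Longrightarrow> \<omega> \<in> space M \<Longrightarrow>
                   T e (T e' \<omega>) = T e' (T e \<omega>)"
    and T_inv: "\<And>e \<omega>. e \<in> nbrs \<Longrightarrow> \<omega> \<in> space M \<Longrightarrow> T (- e) (T e \<omega>) = \<omega>"
begin

lemma T_space: "e \<in> nbrs \<Longrightarrow> \<omega> \<in> space M \<Longrightarrow> T e \<omega> \<in> space M"
  using T_meas measurable_space by metis

lemma T_inv': "e \<in> nbrs \<Longrightarrow> \<omega> \<in> space M \<Longrightarrow> T e (T (- e) \<omega>) = \<omega>"
  using T_inv[of "- e"] by simp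

lemma Tpow_meas: "e \<in> nbrs \<Longrightarrow> T e ^^ n \<in> M \<rightarrow>\<^sub>M M"
  by (induction n) (auto intro: measurable_comp T_meas simp: id_def)

lemma Tpow_pres: "e \<in> nbrs \<Longrightarrow> distr M M (T e ^^ n) = M"
proof (induction n)
  case (Suc n)
  have "distr M M (T e ^^ Suc n) = distr (distr M M (T e ^^ n)) M (T e)"
    using Suc.prems by (subst distr_distr) (auto simp: T_meas Tpow_meas)
  with Suc show ?case
    by (simp only: T_pres Suc.IH Suc.prems)
qed (simp add: id_def)

lemma Upow_meas: "e \<in> nbrs \<Longrightarrow> Upow T e k \<in> M \<rightarrow>\<^sub>M M"
  by (simp add: Upow_def Tpow_meas)

lemma Upow_pres: "e \<in> nbrs \<Longrightarrow> distr M M (Upow T e k) = M"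
  by (simp add: Upow_def Tpow_pres)

lemma Upow_space: "e \<in> nbrs \<Longrightarrow> \<omega> \<in> space M \<Longrightarrow> Upow T e k \<omega> \<in> space M"
  using Upow_meas measurable_space by metis

lemma Upow_0: "Upow T e 0 \<omega> = \<omega>"
  by (simp add: Upow_def)

lemma Upow_add1:
  assumes "e \<in> nbrs" "\<omega> \<in> space M"
  shows "Upow T e (k + 1) \<omega> = T e (Upow T e k \<omega>)"
proof (cases "k \<ge> 0")
  case True
  then have "nat (k + 1) = Suc (nat k)"
    by simp
  with True show ?thesis
    by (simp add: Upow_def)
next
  case False
  define m where "m = nat (- (k + 1))"
  have m: "nat (- k) = Suc m"
    using False by (simp add: m_def)
  have "(T (- e) ^^ m) \<omega> \<in> space M"
    using assms measurable_space[OF Tpow_meas[of "- e" m]] by simp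
  then have "T e (Upow T e k \<omega>) = (T (- e) ^^ m) \<omega>"
    using False assms m by (simp add: Upow_def T_inv')
  \<comment> \<open>At k = -1 the exponent k + 1 is 0, which \<open>Upow\<close> sends to its
    nonnegative branch; both branches then give the identity.\<close>
  also have "\<dots> = Upow T e (k + 1) \<omega>"
    using False by (cases "k = - 1") (auto simp: Upow_def m_def)
  finally show ?thesis ..
qed

lemma Upow_diff1:
  assumes "e \<in> nbrs" "\<omega> \<in> space M"
  shows "Upow T e (k - 1) \<omega> = T (- e) (Upow T e k \<omega>)"
  using Upow_add1[OF assms, of "k - 1"] assms by (simp add: T_inv Upow_space)

lemma Upow_add:
  assumes "e \<in> nbrs" "\<omega> \<in> space M"
  shows "Upow T e (k + k') \<omega> = Upow T e k (Upow T e k' \<omega>)"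
proof (induction k rule: int_induct[where k = 0])
  case (step1 i)
  then show ?case
    using assms Upow_add1[of e \<omega> "i + k'"] Upow_add1[of e "Upow T e k' \<omega>" i]
    by (simp add: Upow_space algebra_simps)
next
  case (step2 i)
  then show ?case
    using assms Upow_diff1[of e \<omega> "i + k'"] Upow_diff1[of e "Upow T e k' \<omega>" i]
    by (simp add: Upow_space algebra_simps)
qed (simp add: Upow_0)

lemma T_Upow_comm:
  assumes "e \<in> nbrs" "e' \<in> nbrs" "\<omega> \<in> space M"
  shows "T e (Upow T e' k \<omega>) = Upow T e' k (T e \<omega>)"
proof (induction k rule: int_induct[where k = 0])
  case (step1 i)
  then show ?case
    using assms by (simp add: Upow_add1 T_space Upow_space T_comm[of e e'])
next
  case (step2 i)
  then show ?case
    using assms by (simp add: Upow_diff1 T_space Upow_space T_comm[of e "- e'"])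
qed (simp add: Upow_0)

lemma Upow_comm:
  assumes "e \<in> nbrs" "e' \<in> nbrs" "\<omega> \<in> space M"
  shows "Upow T e k (Upow T e' k' \<omega>) = Upow T e' k' (Upow T e k \<omega>)"
proof (induction k rule: int_induct[where k = 0])
  case (step1 i)
  then show ?case
    using assms by (simp add: Upow_add1 Upow_space T_Upow_comm)
next
  case (step2 i)
  then show ?case
    using assms by (simp add: Upow_diff1 Upow_space T_Upow_comm)
qed (simp add: Upow_0)

text \<open>\<open>Tshift\<close> folds over a list picked by \<open>SOME\<close>. With the list as
  a parameter, its properties can be proved by induction, and \<open>Tshift_eq_shift_along\<close>
  carries them back.\<close>

definition shift_along :: "'d list \<Rightarrow> int^'d \<Rightarrow> 'w \<Rightarrow> 'w" where
  "shift_along l x = foldr (\<lambda>i f. Upow T (axis i 1) (x $ i) \<circ> f) l id"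

lemma shift_along_simps [simp]:
  "shift_along [] x = id"
  "shift_along (i # l) x = Upow T (axis i 1) (x $ i) \<circ> shift_along l x"
  by (simp_all add: shift_along_def)

lemma shift_along_meas: "shift_along l x \<in> M \<rightarrow>\<^sub>M M"
  by (induction l) (auto intro: measurable_comp Upow_meas simp: id_def simp del: o_apply comp_apply)

lemma shift_along_space: "\<omega> \<in> space M \<Longrightarrow> shift_along l x \<omega> \<in> space M"
  using shift_along_meas measurable_space by metis

lemma shift_along_pres: "distr M M (shift_along l x) = M"
proof (induction l)
  case (Cons i l)
  have "distr M M (shift_along (i # l) x)
      = distr (distr M M (shift_along l x)) M (Upow T (axis i 1) (x $ i))"
    by (simp add: distr_distr Upow_meas shift_along_meas)
  with Cons show ?case
    by (simp only: Upow_pres[OF axis_in_nbrs] Cons.IH)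
qed (simp add: id_def)

lemma Upow_shift_along_comm:
  assumes "e \<in> nbrs" "\<omega> \<in> space M"
  shows "Upow T e k (shift_along l x \<omega>) = shift_along l x (Upow T e k \<omega>)"
  using assms
  by (induction l) (auto simp: shift_along_space Upow_comm[of e "axis _ 1"])

text \<open>The power belonging to \<open>y\<close> in the first coordinate of the list commutes
  past \<open>shift_along l x\<close>, so the two folds interleave coordinate by coordinate.\<close>

lemma shift_along_add:
  assumes "\<omega> \<in> space M"
  shows "shift_along l (x + y) \<omega> = shift_along l x (shift_along l y \<omega>)"
  using assms
  by (induction l)
     (auto simp: shift_along_space Upow_add Upow_shift_along_comm Upow_space)

lemma shift_along_axis:
  assumes "distinct l"
  shows "shift_along l (axis i k) \<omega> = (if i \<in> set l then Upow T (axis i 1) k \<omega> else \<omega>)"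
  using assms by (induction l) (auto simp: axis_def Upow_0)

lemma Tshift_eq_shift_along:
  obtains l where "Tshift T = shift_along l" "distinct l" "set l = UNIV"
proof -
  define l where "l = (SOME l. distinct l \<and> set l = (UNIV :: 'd set))"
  have "\<exists>l. distinct l \<and> set l = (UNIV :: 'd set)"
    using finite_distinct_list[OF finite[of "UNIV :: 'd set"]] by blast
  from someI_ex[OF this] have "distinct l" "set l = UNIV"
    by (auto simp: l_def)
  moreover have "Tshift T = shift_along l"
    by (auto simp: Tshift_def shift_along_def l_def)
  ultimately show ?thesis
    using that by blast
qed

lemma Tshift_meas [measurable]: "Tshift T x \<in> M \<rightarrow>\<^sub>M M"
  by (metis Tshift_eq_shift_along shift_along_meas)

lemma Tshift_pres: "distr M M (Tshift T x) = M"
  by (metis Tshift_eq_shift_along shift_along_pres)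

lemma Tshift_space [simp, intro]: "\<omega> \<in> space M \<Longrightarrow> Tshift T x \<omega> \<in> space M"
  by (metis Tshift_eq_shift_along shift_along_space)

lemma Tshift_add: "\<omega> \<in> space M \<Longrightarrow> Tshift T (x + y) \<omega> = Tshift T x (Tshift T y \<omega>)"
  by (metis Tshift_eq_shift_along shift_along_add)

lemma Tshift_axis: "Tshift T (axis i k) \<omega> = Upow T (axis i 1) k \<omega>"
proof -
  obtain l where "Tshift T = shift_along l" "distinct l" "set l = UNIV"
    by (rule Tshift_eq_shift_along)
  then show ?thesis
    by (simp add: shift_along_axis)
qed

lemma Tshift_0 [simp]: "Tshift T 0 \<omega> = \<omega>"
  using Tshift_axis[of undefined 0] by (simp add: Upow_0 axis_def zero_vec_def cong: if_cong)

lemma Tshift_nbr: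
  assumes "e \<in> nbrs"
  shows "Tshift T e \<omega> = T e \<omega>"
proof -
  consider i where "e = axis i 1" | i where "e = axis i (-1)"
    using assms by (fastforce simp: nbrs_eq axis_def vec_eq_iff)
  then show ?thesis
  proof cases
    case 1
    then show ?thesis
      by (simp add: Tshift_axis Upow_def)
  next
    case (2 i)
    then have "e = - axis i 1"
      by (simp add: vec_eq_iff axis_def)
    with 2 show ?thesis
      by (simp add: Tshift_axis Upow_def)
  qed
qed

section \<open>Transport of almost sure statements and integrals along shifts\<close>

lemma AE_Tshift:
  assumes "AE \<omega> in M. P \<omega>"
  shows "AE \<omega> in M. P (Tshift T x \<omega>)"
proof -
  have "AE \<omega> in distr M M (Tshift T x). P \<omega>"
    unfolding Tshift_pres by (fact assms)
  from AE_distrD[OF Tshift_meas this] show ?thesis .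
qed

lemma AE_all_Tshift:
  assumes "AE \<omega> in M. P \<omega>"
  shows "AE \<omega> in M. \<forall>x. P (Tshift T x \<omega>)"
  using assms by (simp add: AE_all_countable AE_Tshift)

lemma integrable_Tshift:
  fixes g :: "'w \<Rightarrow> real"
  assumes "integrable M g"
  shows "integrable M (\<lambda>\<omega>. g (Tshift T x \<omega>))"
proof -
  have "integrable (distr M M (Tshift T x)) g"
    using assms by (simp add: Tshift_pres)
  then show ?thesis
    by (rule integrable_distr[OF Tshift_meas])
qed

lemma integral_Tshift:
  fixes g :: "'w \<Rightarrow> real"
  assumes "g \<in> borel_measurable M"
  shows "(\<integral>\<omega>. g (Tshift T x \<omega>) \<partial>M) = (\<integral>\<omega>. g \<omega> \<partial>M)"
  using integral_distr[OF Tshift_meas assms, of x] by (simp add: Tshift_pres)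

end

section \<open>Maximal inequality over cubes\<close>

lemma bij_betw_vec_lambda_PiE:
  "bij_betw vec_lambda (PiE UNIV I) {y :: 'a^'d::finite. \<forall>i. y $ i \<in> I i}"
  by (rule bij_betw_byWitness[where f' = vec_nth]) (auto simp: PiE_def Pi_def)

lemma finite_vec_box: "(\<And>i. finite (I i)) \<Longrightarrow> finite {y :: 'a^'d::finite. \<forall>i. y $ i \<in> I i}"
  using bij_betw_finite[OF bij_betw_vec_lambda_PiE[of I]] by (simp add: finite_PiE)

lemma card_vec_box: "card {y :: 'a^'d::finite. \<forall>i. y $ i \<in> I i} = (\<Prod>i\<in>UNIV. card (I i))"
  using bij_betw_same_card[OF bij_betw_vec_lambda_PiE[of I]] by (simp add: card_PiE)

definition cube :: "nat \<Rightarrow> int^'d::finite \<Rightarrow> (int^'d) set" where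
  "cube n x = {y. \<forall>i. \<bar>y $ i - x $ i\<bar> \<le> int n}"

lemma cube_eq_box: "cube n x = {y. \<forall>i. y $ i \<in> {x $ i - int n..x $ i + int n}}"
proof -
  have "\<bar>y $ i - x $ i\<bar> \<le> int n \<longleftrightarrow> y $ i \<in> {x $ i - int n..x $ i + int n}" for y i
    by auto
  then show ?thesis
    unfolding cube_def by simp
qed

lemma finite_cube [simp, intro]: "finite (cube n x)"
  unfolding cube_eq_box by (rule finite_vec_box) simp

lemma card_cube: "card (cube n (x :: int^'d::finite)) = (2 * n + 1) ^ CARD('d)"
proof -
  have "nat (x $ i + int n - (x $ i - int n) + 1) = 2 * n + 1" for i
    by simp
  then show ?thesis
    unfolding cube_eq_box card_vec_box card_atLeastAtMost_int by (simp add: algebra_simps)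
qed

lemma centre_in_cube [simp, intro]: "x \<in> cube n x"
  by (simp add: cube_def)

lemma cube_mono: "m \<le> n \<Longrightarrow> cube m x \<subseteq> cube n x"
  by (auto simp: cube_def dest: spec intro: order_trans)

lemma cube_subset_cube_0:
  assumes "x \<in> cube m 0"
  shows "cube n x \<subseteq> cube (m + n) 0"
proof
  fix y
  assume "y \<in> cube n x"
  then have "\<bar>y $ i\<bar> \<le> int (m + n)" for i
    using assms by (auto simp: cube_def dest!: spec[of _ i])
  then show "y \<in> cube (m + n) 0"
    by (simp add: cube_def)
qed

lemma sum_cube_shift:
  "(\<Sum>y\<in>cube n 0. h (y + x)) = (\<Sum>y\<in>cube n x. h y)" for h :: "int^'d::finite \<Rightarrow> real"
  by (rule sum.reindex_bij_witness[of _ "\<lambda>y. y - x" "\<lambda>y. y + x"]) (auto simp: cube_def)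

text \<open>Greedy selection: keep a centre of largest radius, discard every centre whose cube meets
  its cube, and recurse on the rest. Only the centres have to be covered, which is why doubling the
  radius suffices where covering the whole cubes would take tripling.\<close>

lemma Vitali_covering_cubes:
  fixes n :: "int^'d::finite \<Rightarrow> nat"
  assumes "finite A"
  shows "\<exists>B\<subseteq>A. disjoint_family_on (\<lambda>x. cube (n x) x) B \<and> A \<subseteq> (\<Union>x\<in>B. cube (2 * n x) x)"
  using assms
proof (induction A rule: finite_psubset_induct)
  case (psubset A)
  show ?case
  proof (cases "A = {}")
    case False
    obtain x where x: "x \<in> A" "\<And>y. y \<in> A \<Longrightarrow> n y \<le> n x"
    proof -
      have "Max (n ` A) \<in> n ` A"
        using psubset.hyps False by simp
      then obtain x where "x \<in> A" "n x = Max (n ` A)"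
        by auto
      with psubset.hyps that show ?thesis
        by simp
    qed
    define A' where "A' = {y \<in> A. cube (n y) y \<inter> cube (n x) x = {}}"
    have "x \<notin> A'"
      by (auto simp: A'_def)
    then have "A' \<subset> A"
      using x(1) by (auto simp: A'_def)
    then obtain B where B: "B \<subseteq> A'" "disjoint_family_on (\<lambda>x. cube (n x) x) B"
      "A' \<subseteq> (\<Union>x\<in>B. cube (2 * n x) x)"
      using psubset.IH by blast
    have "y \<in> cube (2 * n x) x" if y: "y \<in> A" "y \<notin> A'" for y
    proof -
      obtain z where z: "z \<in> cube (n y) y" "z \<in> cube (n x) x"
        using y unfolding A'_def by blast
      have "\<bar>y $ i - x $ i\<bar> \<le> 2 * int (n x)" for i
      proof -
        have "\<bar>z $ i - y $ i\<bar> \<le> int (n y)" "\<bar>z $ i - x $ i\<bar> \<le> int (n x)"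
          using z by (auto simp: cube_def)
        moreover have "int (n y) \<le> int (n x)"
          using x(2) \<open>y \<in> A\<close> by simp
        ultimately show ?thesis
          by linarith
      qed
      then show ?thesis
        by (simp add: cube_def)
    qed
    then have "A \<subseteq> (\<Union>x\<in>insert x B. cube (2 * n x) x)"
      using B(3) by blast
    moreover have "disjoint_family_on (\<lambda>x. cube (n x) x) (insert x B)"
    proof -
      have "cube (n y) y \<inter> cube (n x) x = {}" if "y \<in> B" for y
        using that B(1) by (auto simp: A'_def)
      then show ?thesis
        using B(2) by (fastforce simp: disjoint_family_on_def)
    qed
    moreover have "insert x B \<subseteq> A"
      using B(1) x(1) by (auto simp: A'_def)
    ultimately show ?thesis
      by blast
  qed (auto simp: disjoint_family_on_def)
qed

text \<open>Deterministic weak-type bound for the maximal function of \<open>v\<close>. The heavy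
  cubes selected by the covering lemma are disjoint, so their masses add up to at most the total
  mass, while their doubles contain all of \<open>A\<close>.\<close>

lemma card_heavy_points_le:
  fixes v :: "int^'d::finite \<Rightarrow> real"
  assumes v: "\<And>x. v x \<ge> 0" and "c > 0"
    and A: "A \<subseteq> cube N 0"
    and heavy: "\<And>x. x \<in> A \<Longrightarrow> \<exists>n\<le>N. c * (2 * real n + 1) ^ CARD('d) < (\<Sum>y\<in>cube n x. v y)"
  shows "c * real (card A) \<le> 2 ^ CARD('d) * (\<Sum>y\<in>cube (2 * N) 0. v y)"
proof -
  have "\<forall>x\<in>A. \<exists>n. n \<le> N \<and> c * (2 * real n + 1) ^ CARD('d) < (\<Sum>y\<in>cube n x. v y)"
    using heavy by blast
  from bchoice[OF this]
  obtain n where n: "\<And>x. x \<in> A \<Longrightarrow> n x \<le> N \<and> c * (2 * real (n x) + 1) ^ CARD('d) < (\<Sum>y\<in>cube (n x) x. v y)"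
    by blast
  have finA: "finite A"
    using A finite_subset by blast
  obtain B where B: "B \<subseteq> A" "disjoint_family_on (\<lambda>x. cube (n x) x) B"
    "A \<subseteq> (\<Union>x\<in>B. cube (2 * n x) x)"
    using Vitali_covering_cubes[OF finA] by blast
  have finB: "finite B"
    using B(1) finA finite_subset by blast
  have "real (card A) \<le> real (card (\<Union>x\<in>B. cube (2 * n x) x))"
    using B(3) finB by (intro of_nat_mono card_mono) auto
  also have "\<dots> \<le> (\<Sum>x\<in>B. real (card (cube (2 * n x) x)))"
    using of_nat_mono[OF card_UN_le[OF finB, of "\<lambda>x. cube (2 * n x) x"], where 'a = real] by simp
  \<comment> \<open>Doubling the radius n gives side 4n + 1, which is at most 2(2n + 1); this is the
    origin of the factor 2^d.\<close>
  also have "\<dots> \<le> (\<Sum>x\<in>B. (2 * (2 * real (n x) + 1)) ^ CARD('d))"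
    by (intro sum_mono) (auto simp: card_cube intro!: power_mono)
  finally have "c * real (card A) \<le> c * (\<Sum>x\<in>B. (2 * (2 * real (n x) + 1)) ^ CARD('d))"
    using \<open>c > 0\<close> by simp
  also have "\<dots> = 2 ^ CARD('d) * (\<Sum>x\<in>B. c * (2 * real (n x) + 1) ^ CARD('d))"
    by (simp only: power_mult_distrib sum_distrib_left mult_ac)
  also have "\<dots> \<le> 2 ^ CARD('d) * (\<Sum>x\<in>B. \<Sum>y\<in>cube (n x) x. v y)"
    using n B(1) by (intro mult_left_mono sum_mono) (auto intro: less_imp_le)
  also have "(\<Sum>x\<in>B. \<Sum>y\<in>cube (n x) x. v y) = (\<Sum>y\<in>(\<Union>x\<in>B. cube (n x) x). v y)"
    using B(2) finB by (subst sum.UNION_disjoint) (auto simp: disjoint_family_on_def)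
  also have "\<dots> \<le> (\<Sum>y\<in>cube (2 * N) 0. v y)"
  proof (rule sum_mono2)
    have "cube (n x) x \<subseteq> cube (2 * N) 0" if "x \<in> B" for x
    proof -
      have "cube (n x) x \<subseteq> cube N x"
        using n B(1) that by (intro cube_mono) auto
      also have "\<dots> \<subseteq> cube (2 * N) 0"
        using cube_subset_cube_0[of x N N] A B(1) that unfolding mult_2 by blast
      finally show ?thesis .
    qed
    then show "(\<Union>x\<in>B. cube (n x) x) \<subseteq> cube (2 * N) 0"
      by blast
  qed (auto simp: v)
  finally show ?thesis
    by simp
qed

context lattice_action
begin

text \<open>Transference: the counting bound is applied to the values of \<open>u\<close> along the
  orbit of each point and then integrated. Invariance turns both sides into multiples of (2N + 1)^d,
  which cancels, so the bound is uniform in N. One factor 2^d comes from the covering, the other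
  from comparing the cubes of radius 2N and N.\<close>

lemma maximal_inequality:
  fixes u :: "'w \<Rightarrow> real"
  assumes u: "\<And>\<omega>. u \<omega> \<ge> 0" and int: "integrable M u" and "c > 0"
  defines "E \<equiv> \<lambda>N. {\<omega> \<in> space M. \<exists>n\<le>N. c * (2 * real n + 1) ^ CARD('d) < (\<Sum>y\<in>cube n 0. u (Tshift T y \<omega>))}"
  shows "prob (E N) \<le> 4 ^ CARD('d) * expectation u / c"
proof -
  have [measurable]: "u \<in> borel_measurable M"
    using int by simp
  have E [measurable]: "E N \<in> sets M"
    unfolding E_def by measurable
  have pointwise: "c * (\<Sum>x\<in>cube N 0. indicator (E N) (Tshift T x \<omega>))
      \<le> 2 ^ CARD('d) * (\<Sum>y\<in>cube (2 * N) 0. u (Tshift T y \<omega>))" if \<omega>: "\<omega> \<in> space M" for \<omega>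
  proof -
    define A where "A = {x \<in> cube N 0. Tshift T x \<omega> \<in> E N}"
    have "\<exists>n\<le>N. c * (2 * real n + 1) ^ CARD('d) < (\<Sum>y\<in>cube n x. u (Tshift T y \<omega>))" if "x \<in> A" for x
    proof -
      have "(\<Sum>y\<in>cube n 0. u (Tshift T y (Tshift T x \<omega>))) = (\<Sum>y\<in>cube n x. u (Tshift T y \<omega>))" for n
        using sum_cube_shift[of "\<lambda>y. u (Tshift T y \<omega>)" x n] \<omega> by (simp add: Tshift_add)
      then show ?thesis
        using that by (simp add: A_def E_def)
    qed
    then have "c * real (card A) \<le> 2 ^ CARD('d) * (\<Sum>y\<in>cube (2 * N) 0. u (Tshift T y \<omega>))"
      by (intro card_heavy_points_le) (auto simp: u \<open>c > 0\<close> A_def)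
    moreover have "(\<Sum>x\<in>cube N 0. indicator (E N) (Tshift T x \<omega>)) = real (card A)"
      by (simp add: A_def indicator_def sum.If_cases Int_def)
    ultimately show ?thesis
      by simp
  qed
  have ind: "integrable M (indicator (E N) :: 'w \<Rightarrow> real)"
    using E by (simp add: integrable_indicator_iff emeasure_eq_measure)
  have "expectation (\<lambda>\<omega>. c * (\<Sum>x\<in>cube N 0. indicator (E N) (Tshift T x \<omega>)))
      \<le> expectation (\<lambda>\<omega>. 2 ^ CARD('d) * (\<Sum>y\<in>cube (2 * N) 0. u (Tshift T y \<omega>)))"
    by (intro integral_mono pointwise integrable_mult_right Bochner_Integration.integrable_sum integrable_Tshift ind int)
  also have "\<dots> = 2 ^ CARD('d) * ((4 * real N + 1) ^ CARD('d) * expectation u)"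
    using int by (simp add: integrable_Tshift integral_Tshift card_cube add.commute)
  also have "\<dots> \<le> 2 ^ CARD('d) * ((2 * (2 * real N + 1)) ^ CARD('d) * expectation u)"
    using u by (intro mult_left_mono mult_right_mono power_mono) auto
  also have "expectation (\<lambda>\<omega>. c * (\<Sum>x\<in>cube N 0. indicator (E N) (Tshift T x \<omega>)))
      = c * ((2 * real N + 1) ^ CARD('d) * prob (E N))"
    using integral_Tshift[of "indicator (E N)"] by (simp add: integrable_Tshift[OF ind] card_cube add.commute)
  finally have "(2 * real N + 1) ^ CARD('d) * (c * prob (E N))
      \<le> (2 * real N + 1) ^ CARD('d) * (2 ^ CARD('d) * 2 ^ CARD('d) * expectation u)"
    by (simp only: power_mult_distrib mult_ac)
  then have "c * prob (E N) \<le> 2 ^ CARD('d) * 2 ^ CARD('d) * expectation u"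
    by (rule mult_left_le_imp_le) (auto intro: zero_less_power)
  then show ?thesis
    using \<open>c > 0\<close> by (simp add: field_simps flip: power_mult_distrib)
qed

text \<open>Uniformity in N lets the maximal inequality pass to the increasing union
  \<open>H c\<close>, the event that some average exceeds c. Its probability is O(1/c), so almost
  surely some finite c bounds all averages.\<close>

lemma AE_bounded_cube_averages:
  fixes u :: "'w \<Rightarrow> real"
  assumes u: "\<And>\<omega>. u \<omega> \<ge> 0" and int: "integrable M u"
  shows "AE \<omega> in M. \<exists>K>0. \<forall>n. (\<Sum>y\<in>cube n 0. u (Tshift T y \<omega>)) \<le> K * (2 * real n + 1) ^ CARD('d)"
proof -
  have [measurable]: "u \<in> borel_measurable M"
    using int by simp
  define E where "E = (\<lambda>c N. {\<omega> \<in> space M. \<exists>n\<le>N. c * (2 * real n + 1) ^ CARD('d) < (\<Sum>y\<in>cube n 0. u (Tshift T y \<omega>))})"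
  have E [measurable]: "E c N \<in> sets M" for c N
    unfolding E_def by measurable
  define H where "H = (\<lambda>c. \<Union>N. E c N)"
  have H [measurable]: "H c \<in> sets M" for c
    unfolding H_def by measurable
  have prob_H: "prob (H c) \<le> 4 ^ CARD('d) * expectation u / c" if "c > 0" for c
  proof (rule LIMSEQ_le_const2)
    show "(\<lambda>N. prob (E c N)) \<longlonglongrightarrow> prob (H c)"
      unfolding H_def
    proof (rule finite_Lim_measure_incseq)
      show "incseq (E c)"
        unfolding incseq_def E_def by (blast intro: order_trans)
    qed auto
    show "\<exists>N0. \<forall>N\<ge>N0. prob (E c N) \<le> 4 ^ CARD('d) * expectation u / c"
      using maximal_inequality[OF u int that] by (auto simp: E_def)
  qed
  \<comment> \<open>The exceptional event: no constant bounds the averages.\<close>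
  define B where "B = (\<Inter>k. H (real (Suc k)))"
  have [measurable]: "B \<in> sets M"
    unfolding B_def by measurable
  have "prob B \<le> 0"
  proof (rule LIMSEQ_le_const)
    show "(\<lambda>k. 4 ^ CARD('d) * expectation u * inverse (real (Suc k))) \<longlonglongrightarrow> 0"
      using tendsto_mult_right[OF LIMSEQ_inverse_real_of_nat, of "4 ^ CARD('d) * expectation u"]
      by (simp add: mult_ac)
    have "prob B \<le> 4 ^ CARD('d) * expectation u * inverse (real (Suc k))" for k
    proof -
      have "prob B \<le> prob (H (real (Suc k)))"
        by (rule finite_measure_mono) (auto simp: B_def)
      also have "\<dots> \<le> 4 ^ CARD('d) * expectation u * inverse (real (Suc k))"
        using prob_H[of "real (Suc k)"] by (simp add: field_simps)
      finally show ?thesis .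
    qed
    then show "\<exists>N. \<forall>n\<ge>N. prob B \<le> 4 ^ CARD('d) * expectation u * inverse (real (Suc n))"
      by blast
  qed
  then have "B \<in> null_sets M"
    by (intro null_setsI) (auto simp: emeasure_eq_measure measure_le_0_iff)
  then have "AE \<omega> in M. \<omega> \<notin> B"
    by (rule AE_not_in)
  then show ?thesis
  proof (rule AE_mp, intro AE_I2 impI)
    fix \<omega>
    assume "\<omega> \<in> space M" "\<omega> \<notin> B"
    then obtain k where "\<omega> \<notin> H (real (Suc k))"
      by (auto simp: B_def)
    then have "(\<Sum>y\<in>cube n 0. u (Tshift T y \<omega>)) \<le> real (Suc k) * (2 * real n + 1) ^ CARD('d)" for n
      using \<open>\<omega> \<in> space M\<close> by (auto simp: H_def E_def not_less dest!: spec[of _ n])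
    then show "\<exists>K>0. \<forall>n. (\<Sum>y\<in>cube n 0. u (Tshift T y \<omega>)) \<le> K * (2 * real n + 1) ^ CARD('d)"
      by (intro exI[of _ "real (Suc k)"]) auto
  qed
qed

end

section \<open>Morrey inequality on dyadic cubes\<close>

text \<open>The step that leaves the interval at its upper end is included, so that in a box the
  increments are indexed by the points of the box itself.\<close>

lemma abs_diff_le_sum_increments:
  fixes h :: "int \<Rightarrow> real"
  assumes "t \<in> {a..<b}" "t' \<in> {a..<b}"
  shows "\<bar>h t - h t'\<bar> \<le> (\<Sum>s\<in>{a..<b}. \<bar>h (s + 1) - h s\<bar>)"
proof -
  have aux: "\<bar>h v - h u\<bar> \<le> (\<Sum>s\<in>{a..<b}. \<bar>h (s + 1) - h s\<bar>)" if "a \<le> u" "u \<le> v" "v < b" for u v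
  proof -
    have "\<bar>h v - h u\<bar> \<le> (\<Sum>s\<in>{u..<v}. \<bar>h (s + 1) - h s\<bar>)"
      using \<open>u \<le> v\<close>
    proof (induction v rule: int_ge_induct)
      case (step v)
      have "{u..<v + 1} = insert v {u..<v}"
        using step.hyps by auto
      then show ?case
        using step.IH by simp
    qed simp
    also have "\<dots> \<le> (\<Sum>s\<in>{a..<b}. \<bar>h (s + 1) - h s\<bar>)"
      using that by (intro sum_mono2) auto
    finally show ?thesis .
  qed
  show ?thesis
    using aux[of t t'] aux[of t' t] assms by (cases "t \<le> t'") (auto simp: abs_minus_commute)
qed

section \<open>Mean oscillation over a box\<close>

definition subst_coord :: "'a^'d::finite \<Rightarrow> 'd \<Rightarrow> 'a \<Rightarrow> 'a^'d" where
  "subst_coord y i t = (\<chi> j. if j = i then t else y $ j)"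

definition merge :: "'d::finite set \<Rightarrow> 'a^'d \<Rightarrow> 'a^'d \<Rightarrow> 'a^'d" where
  "merge S y' y = (\<chi> j. if j \<in> S then y' $ j else y $ j)"

definition side_box :: "nat \<Rightarrow> int^'d::finite \<Rightarrow> (int^'d) set" where
  "side_box L a = {y. \<forall>i. y $ i \<in> {a $ i..<a $ i + int L}}"

lemma finite_side_box [simp, intro]: "finite (side_box L a)"
  unfolding side_box_def by (rule finite_vec_box) simp

lemma card_side_box: "card (side_box L (a :: int^'d::finite)) = L ^ CARD('d)"
  unfolding side_box_def card_vec_box by simp

lemma sum_coordinate_oscillation_le:
  fixes f :: "int^'d::finite \<Rightarrow> real" and a :: "int^'d" and L :: nat
  defines "B \<equiv> side_box L a"
  shows "(\<Sum>(y, y')\<in>B \<times> B. \<bar>f (subst_coord y i (y' $ i)) - f y\<bar>)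
       \<le> real (card B) * real L * (\<Sum>z\<in>B. \<bar>f (z + axis i 1) - f z\<bar>)"
proof -
  define I where "I = {a $ i..<a $ i + int L}"
  define D where "D = (\<lambda>z. \<bar>f (z + axis i 1) - f z\<bar>)"
  have coord: "y $ i \<in> I" if "y \<in> B" for y
    using that by (auto simp: B_def side_box_def I_def)
  have line: "\<bar>f (subst_coord y i (y' $ i)) - f y\<bar> \<le> (\<Sum>s\<in>I. D (subst_coord y i s))"
    if "y \<in> B" "y' \<in> B" for y y'
  proof -
    have [simp]: "subst_coord y i (y $ i) = y" "subst_coord y i (s + 1) = subst_coord y i s + axis i 1" for s
      by (simp_all add: subst_coord_def vec_eq_iff axis_def)
    show ?thesis
      using abs_diff_le_sum_increments[of "y' $ i" "a $ i" "a $ i + int L" "y $ i" "\<lambda>t. f (subst_coord y i t)"]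
        coord[OF that(1)] coord[OF that(2)]
      by (simp add: I_def D_def)
  qed
  have "(\<Sum>(y, y')\<in>B \<times> B. \<bar>f (subst_coord y i (y' $ i)) - f y\<bar>)
      \<le> (\<Sum>(y, y')\<in>B \<times> B. \<Sum>s\<in>I. D (subst_coord y i s))"
    using line by (intro sum_mono) auto
  also have "\<dots> = real (card B) * (\<Sum>y\<in>B. \<Sum>s\<in>I. D (subst_coord y i s))"
    by (simp add: sum.cartesian_product' [symmetric] sum_distrib_left flip: sum.cartesian_product)
  also have "(\<Sum>y\<in>B. \<Sum>s\<in>I. D (subst_coord y i s)) = (\<Sum>(y, s)\<in>B \<times> I. D (subst_coord y i s))"
    by (simp add: sum.cartesian_product)
  \<comment> \<open>Exchanging the i-th coordinate of the point with the free parameter is an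
    involution of \<open>B \<times> I\<close>. Hence every z is counted once for each point of its
    line in direction i, that is L times.\<close>
  also have "\<dots> = (\<Sum>(z, s)\<in>B \<times> I. D z)"
    by (rule sum.reindex_bij_witness[of _ "\<lambda>(z, s). (subst_coord z i s, z $ i)" "\<lambda>(y, s). (subst_coord y i s, y $ i)"])
       (auto simp: subst_coord_def vec_eq_iff B_def side_box_def I_def)
  also have "\<dots> = real L * (\<Sum>z\<in>B. D z)"
    by (simp add: I_def sum_distrib_left flip: sum.cartesian_product)
  finally show ?thesis
    by (simp add: D_def mult_ac)
qed

text \<open>The L1 form is enough, because the exponent q is brought in afterwards by
  \<open>Young_linear\<close>, applied to each increment separately.\<close>

lemma discrete_Poincare:
  fixes f :: "int^'d::finite \<Rightarrow> real" and a :: "int^'d" and L :: nat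
  defines "B \<equiv> side_box L a"
  shows "(\<Sum>(y, y')\<in>B \<times> B. \<bar>f y' - f y\<bar>)
       \<le> real (card B) * real L * (\<Sum>i\<in>UNIV. \<Sum>z\<in>B. \<bar>f (z + axis i 1) - f z\<bar>)"
proof -
  define R where "R = (\<lambda>i. real (card B) * real L * (\<Sum>z\<in>B. \<bar>f (z + axis i 1) - f z\<bar>))"
  have "(\<Sum>(y, y')\<in>B \<times> B. \<bar>f (merge S y' y) - f y\<bar>) \<le> (\<Sum>i\<in>S. R i)" for S
    using finite[of S]
  proof (induction S)
    case empty
    then show ?case
      by (simp add: merge_def case_prod_beta)
  next
    case (insert i S)
    \<comment> \<open>Coordinates are exchanged one at a time; swapping the coordinates in \<open>S\<close> between \<open>y\<close> and \<open>y'\<close>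
      is an involution of \<open>B \<times> B\<close>, so each exchange costs the same as the first one.\<close>
    have step: "merge (insert i S) y' y = subst_coord (merge S y' y) i (merge S y y' $ i)" for y y' :: "int^'d"
      using insert.hyps by (simp add: merge_def subst_coord_def vec_eq_iff)
    have "(\<Sum>(y, y')\<in>B \<times> B. \<bar>f (merge (insert i S) y' y) - f y\<bar>)
        \<le> (\<Sum>(y, y')\<in>B \<times> B. \<bar>f (merge S y' y) - f y\<bar>
            + \<bar>f (subst_coord (merge S y' y) i (merge S y y' $ i)) - f (merge S y' y)\<bar>)"
      unfolding step by (intro sum_mono) (simp add: case_prod_beta)
    also have "\<dots> = (\<Sum>(y, y')\<in>B \<times> B. \<bar>f (merge S y' y) - f y\<bar>)
        + (\<Sum>(y, y')\<in>B \<times> B. \<bar>f (subst_coord (merge S y' y) i (merge S y y' $ i)) - f (merge S y' y)\<bar>)"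
      by (simp add: case_prod_beta sum.distrib)
    also have "(\<Sum>(y, y')\<in>B \<times> B. \<bar>f (subst_coord (merge S y' y) i (merge S y y' $ i)) - f (merge S y' y)\<bar>)
        = (\<Sum>(y, y')\<in>B \<times> B. \<bar>f (subst_coord y i (y' $ i)) - f y\<bar>)"
      by (rule sum.reindex_bij_witness[of _ "\<lambda>(y, y'). (merge S y' y, merge S y y')" "\<lambda>(y, y'). (merge S y' y, merge S y y')"])
         (auto simp: merge_def vec_eq_iff B_def side_box_def)
    also have "\<dots> \<le> R i"
      unfolding R_def B_def by (rule sum_coordinate_oscillation_le)
    finally show ?case
      using insert by simp
  qed
  from this[of UNIV] show ?thesis
    by (simp add: merge_def R_def sum_distrib_left)
qed

definition average :: "('a \<Rightarrow> real) \<Rightarrow> 'a set \<Rightarrow> real" where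
  "average f A = (\<Sum>y\<in>A. f y) / real (card A)"

text \<open>The difference of averages is the mean of f y - f y' over \<open>A \<times> B\<close>.
  Enlarging the absolute sum to \<open>B \<times> B\<close> makes the Poincare bound applicable, and
  its factor \<open>card B\<close> cancels against the normalisation.\<close>

lemma average_diff_le:
  fixes f :: "int^'d::finite \<Rightarrow> real" and a :: "int^'d" and L :: nat
  defines "B \<equiv> side_box L a"
  assumes "A \<subseteq> B" "A \<noteq> {}"
  shows "\<bar>average f A - average f B\<bar>
       \<le> real L / real (card A) * (\<Sum>i\<in>UNIV. \<Sum>z\<in>B. \<bar>f (z + axis i 1) - f z\<bar>)"
proof -
  have fin: "finite A" "finite B"
    using assms(2) finite_subset[OF assms(2)] by (auto simp: B_def)
  have pos: "real (card A) > 0" "real (card B) > 0"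
    using fin assms(2,3) by (auto simp: card_gt_0_iff)
  have "(\<Sum>(y, y')\<in>A \<times> B. f y - f y') = real (card B) * (\<Sum>y\<in>A. f y) - real (card A) * (\<Sum>y\<in>B. f y)"
    by (simp add: sum_subtractf sum_distrib_left flip: sum.cartesian_product)
  then have "average f A - average f B = (\<Sum>(y, y')\<in>A \<times> B. f y - f y') / (real (card A) * real (card B))"
    using pos by (simp add: average_def field_simps)
  then have "\<bar>average f A - average f B\<bar> = \<bar>\<Sum>(y, y')\<in>A \<times> B. f y - f y'\<bar> / (real (card A) * real (card B))"
    by (simp add: abs_mult)
  also have "\<bar>\<Sum>(y, y')\<in>A \<times> B. f y - f y'\<bar> \<le> (\<Sum>(y, y')\<in>A \<times> B. \<bar>f y' - f y\<bar>)"
    by (rule order_trans[OF sum_abs]) (simp add: case_prod_beta abs_minus_commute)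
  also have "\<dots> \<le> (\<Sum>(y, y')\<in>B \<times> B. \<bar>f y' - f y\<bar>)"
    using assms(2) fin by (intro sum_mono2) auto
  also have "\<dots> \<le> real (card B) * real L * (\<Sum>i\<in>UNIV. \<Sum>z\<in>B. \<bar>f (z + axis i 1) - f z\<bar>)"
    unfolding B_def by (rule discrete_Poincare)
  finally show ?thesis
    using pos by (simp add: field_simps)
qed

text \<open>The dyadic cube of side 2^j around x. Stating it through equality of quotients makes
  membership an equivalence relation, so cubes of one level coincide or are disjoint, and levels are
  nested because quotients by 2^j can be divided further.\<close>

definition dyadic :: "nat \<Rightarrow> int^'d::finite \<Rightarrow> (int^'d) set" where
  "dyadic j x = {y. \<forall>i. y $ i div 2 ^ j = x $ i div 2 ^ j}"

lemma dyadic_eq_side_box: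
  "dyadic j x = side_box (2 ^ j) (\<chi> i. 2 ^ j * (x $ i div 2 ^ j))"
proof -
  have "u div 2 ^ j = v div 2 ^ j \<longleftrightarrow> u \<in> {2 ^ j * (v div 2 ^ j)..<2 ^ j * (v div 2 ^ j) + 2 ^ j}" for u v :: int
  proof
    assume "u div 2 ^ j = v div 2 ^ j"
    moreover have "2 ^ j * (u div 2 ^ j) + u mod 2 ^ j = u" "0 \<le> u mod 2 ^ j" "u mod 2 ^ j < 2 ^ j"
      by simp_all
    ultimately show "u \<in> {2 ^ j * (v div 2 ^ j)..<2 ^ j * (v div 2 ^ j) + 2 ^ j}"
      by (simp del: mult_div_mod_eq, linarith)
  next
    assume "u \<in> {2 ^ j * (v div 2 ^ j)..<2 ^ j * (v div 2 ^ j) + 2 ^ j}"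
    then show "u div 2 ^ j = v div 2 ^ j"
      by (intro int_div_pos_eq[of _ _ _ "u - 2 ^ j * (v div 2 ^ j)"]) auto
  qed
  then show ?thesis
    by (simp add: dyadic_def side_box_def)
qed

lemma card_dyadic: "card (dyadic j (x :: int^'d::finite)) = 2 ^ (j * CARD('d))"
  by (simp add: dyadic_eq_side_box card_side_box power_mult)

lemma self_in_dyadic [simp, intro]: "x \<in> dyadic j x"
  by (simp add: dyadic_def)

lemma dyadic_0 [simp]: "dyadic 0 x = {x}"
  by (auto simp: dyadic_def vec_eq_iff)

lemma dyadic_Suc_mono: "dyadic j x \<subseteq> dyadic (Suc j) x"
proof -
  have "u div 2 ^ Suc j = (u div 2 ^ j) div 2" for u :: int
    by (simp only: power_Suc2 zdiv_zmult2_eq zero_le_numeral zero_le_power)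
  then show ?thesis
    by (auto simp: dyadic_def simp del: power_Suc)
qed

lemma dyadic_mono: "j \<le> k \<Longrightarrow> dyadic j x \<subseteq> dyadic k x"
  by (induction k rule: dec_induct) (simp, meson dyadic_Suc_mono order_trans)

lemma dyadic_cong: "y \<in> dyadic j x \<Longrightarrow> dyadic j y = dyadic j x"
  by (simp add: dyadic_def)

text \<open>Either a \<le> t, or a/t \<ge> 1 and a is at most a (a/t)^(q-1). With a suitable
  threshold t this replaces Hoelder's inequality.\<close>

lemma Young_linear:
  fixes a t q :: real
  assumes "a \<ge> 0" "t > 0" "q \<ge> 1"
  shows "a \<le> t + t powr (1 - q) * a powr q"
proof (cases "a \<le> t")
  case False
  with assms have "1 \<le> (a / t) powr (q - 1)"
    by (intro ge_one_powr_ge_zero) auto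
  then have "a * 1 \<le> a * (a / t) powr (q - 1)"
    using assms by (intro mult_left_mono) auto
  also have "\<dots> = t powr (1 - q) * a powr q"
    using assms False by (simp add: powr_divide powr_diff powr_minus field_simps)
  finally show ?thesis
    using assms by simp
qed (use assms in \<open>simp add: add_increasing2\<close>)

text \<open>The mass of \<open>u\<close> is measured against the large scale 2^N, since it may be
  concentrated in one small cube. At scale 2^j the mean of u can thus be as large as 2^((N-j)d), the
  typical increment 2^((N-j)d/q), and the oscillation 2^j times that, which equals 2^N
  \<rho>^(N-j).\<close>

lemma dyadic_average_step:
  fixes f u :: "int^'d::finite \<Rightarrow> real" and q K :: real
  assumes q: "q > real CARD('d)"
    and u: "\<And>y i. \<bar>f (y + axis i 1) - f y\<bar> powr q \<le> u y"
    and K: "(\<Sum>y\<in>dyadic (Suc j) x. u y) \<le> K * 2 ^ (N * CARD('d))"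
    and "j < N"
  defines "\<rho> \<equiv> 2 powr (real CARD('d) / q - 1)"
  shows "\<bar>average f (dyadic j x) - average f (dyadic (Suc j) x)\<bar>
       \<le> 2 * CARD('d) * (2 ^ CARD('d) + K) * 2 ^ N * \<rho> ^ (N - j)"
proof -
  define d where "d = CARD('d)"
  have "d \<ge> 1"
    by (simp add: d_def Suc_leI)
  define m where "m = real (N - j)"
  \<comment> \<open>This threshold balances the two terms of Young's inequality at scale \<open>2 ^ j\<close>, see \<open>t_scale\<close>.\<close>
  define t where "t = 2 powr (m * d / q)"
  have "real d \<ge> 1"
    using \<open>d \<ge> 1\<close> by simp
  then have "q \<ge> 1" "q > 0"
    using q unfolding d_def by linarith+
  have "t > 0"
    by (simp add: t_def)
  have step: "\<bar>f (y + axis i 1) - f y\<bar> \<le> t + t powr (1 - q) * u y" for y i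
  proof -
    have "\<bar>f (y + axis i 1) - f y\<bar> \<le> t + t powr (1 - q) * \<bar>f (y + axis i 1) - f y\<bar> powr q"
      using \<open>q \<ge> 1\<close> \<open>t > 0\<close> by (intro Young_linear) auto
    also have "\<dots> \<le> t + t powr (1 - q) * u y"
      by (intro add_left_mono mult_left_mono u) auto
    finally show ?thesis .
  qed
  define B where "B = dyadic (Suc j) x"
  have cardB: "real (card B) = 2 ^ (j * d) * 2 ^ d"
    by (simp add: B_def card_dyadic d_def power_add)
  have t_scale: "t powr (1 - q) * 2 ^ (N * d) = 2 ^ (j * d) * t"
  proof -
    have "t powr (1 - q) = t * 2 powr (- (m * d))"
      using \<open>q > 0\<close> by (simp add: t_def powr_powr field_simps flip: powr_add)
    moreover have "(2::real) ^ (N * d) = 2 powr (m * d) * 2 ^ (j * d)"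
    proof -
      have "N * d = (N - j) * d + j * d"
        using \<open>j < N\<close> by (simp flip: add_mult_distrib)
      moreover have "2 powr (m * d) = (2::real) ^ ((N - j) * d)"
        by (simp add: m_def powr_realpow flip: of_nat_mult)
      ultimately show ?thesis
        by (metis power_add)
    qed
    ultimately show ?thesis
      by (simp add: powr_minus)
  qed
  have "\<bar>average f (dyadic j x) - average f B\<bar>
      \<le> real (2 ^ Suc j) / real (card (dyadic j x)) * (\<Sum>i\<in>UNIV. \<Sum>z\<in>B. \<bar>f (z + axis i 1) - f z\<bar>)"
    unfolding B_def dyadic_eq_side_box[of "Suc j" x]
    by (rule average_diff_le)
       (use dyadic_Suc_mono[of j x] self_in_dyadic[of x j] dyadic_eq_side_box[of "Suc j" x] in auto)
  also have "\<dots> \<le> real (2 ^ Suc j) / real (card (dyadic j x)) * (\<Sum>i\<in>(UNIV :: 'd set). \<Sum>z\<in>B. t + t powr (1 - q) * u z)"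
    by (intro mult_left_mono sum_mono step) auto
  also have "(\<Sum>i\<in>(UNIV :: 'd set). \<Sum>z\<in>B. t + t powr (1 - q) * u z)
      = d * (real (card B) * t + t powr (1 - q) * (\<Sum>z\<in>B. u z))"
    by (simp add: sum.distrib sum_distrib_left d_def)
  also have "real (2 ^ Suc j) / real (card (dyadic j x)) * \<dots>
      \<le> real (2 ^ Suc j) / real (card (dyadic j x)) * (d * (real (card B) * t + t powr (1 - q) * (K * 2 ^ (N * d))))"
    using K by (intro mult_left_mono add_left_mono) (auto simp: d_def B_def)
  also have "t powr (1 - q) * (K * 2 ^ (N * d)) = 2 ^ (j * d) * t * K"
    using t_scale by (simp add: mult_ac)
  \<comment> \<open>The 2 is the ratio of the side of \<open>B\<close> to 2^j, d counts the
    directions, and 2^d is the ratio of the cardinalities of \<open>B\<close> and the smaller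
    cube.\<close>
  also have "real (2 ^ Suc j) / real (card (dyadic j x)) * (d * (real (card B) * t + 2 ^ (j * d) * t * K))
      = 2 * d * (2 ^ d + K) * (2 ^ j * t)"
    unfolding cardB by (simp add: card_dyadic d_def field_simps)
  also have "2 ^ j * t = 2 ^ N * \<rho> ^ (N - j)"
  proof -
    have "\<rho> ^ (N - j) = 2 powr (m * (d / q - 1))"
      by (simp add: \<rho>_def m_def d_def powr_powr mult_ac flip: powr_realpow)
    also have "\<dots> = t * 2 powr (- m)"
      by (simp add: t_def algebra_simps flip: powr_add)
    also have "2 powr (- m) = 2 ^ j / (2::real) ^ N"
      using \<open>j < N\<close> by (simp add: m_def powr_diff powr_realpow of_nat_diff)
    finally show ?thesis
      by simp
  qed
  finally show ?thesis
    by (simp add: B_def d_def mult_ac)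
qed

text \<open>Averages over the dyadic cubes around a point telescope from the point itself, at level
  0, up to level J. The steps grow geometrically with the level, so the last one dominates. Keeping
  J apart from N exhibits the gain \<rho>^(N-J) for points that share a cube much smaller than
  2^N.\<close>

lemma discrete_Morrey:
  fixes f u :: "int^'d::finite \<Rightarrow> real" and q K :: real
  assumes q: "q > real CARD('d)"
    and u: "\<And>y i. \<bar>f (y + axis i 1) - f y\<bar> powr q \<le> u y"
    and K: "(\<Sum>y\<in>dyadic J x. u y) \<le> K * 2 ^ (N * CARD('d))" "K \<ge> 0"
    and "J \<le> N" and x': "x' \<in> dyadic J x"
  defines "\<rho> \<equiv> 2 powr (real CARD('d) / q - 1)"
  shows "\<bar>f x - f x'\<bar> \<le> 4 * CARD('d) * (2 ^ CARD('d) + K) / (1 - \<rho>) * 2 ^ N * \<rho> ^ (N - J)"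
proof -
  define C where "C = 2 * CARD('d) * (2 ^ CARD('d) + K)"
  have "C \<ge> 0"
    using K by (simp add: C_def)
  have u0: "u y \<ge> 0" for y
    using u[of y undefined] by (meson order_trans powr_ge_zero)
  have "q > 0"
    using q by (meson less_trans of_nat_0_less_iff zero_less_card_finite)
  then have "2 powr (real CARD('d) / q - 1) < 2 powr (0::real)"
    using q by (intro powr_less_mono) auto
  then have \<rho>: "0 < \<rho>" "\<rho> < 1"
    by (auto simp: \<rho>_def)
  have main: "\<bar>f z - average f (dyadic J x)\<bar> \<le> C / (1 - \<rho>) * 2 ^ N * \<rho> ^ (N - J)" if z: "z \<in> dyadic J x" for z
  proof -
    \<comment> \<open>The constant C \<rho> / (1 - \<rho>) is the one the recursion reproduces:
      adding C gives C / (1 - \<rho>), and the missing factor \<rho> is split off from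
      \<rho>^(N-k).\<close>
    have "\<bar>f z - average f (dyadic k z)\<bar> \<le> C * \<rho> / (1 - \<rho>) * 2 ^ N * \<rho> ^ (N - k)" if "k \<le> J" for k
      using that
    proof (induction k)
      case 0
      then show ?case
        using \<open>C \<ge> 0\<close> \<rho> by (simp add: average_def)
    next
      case (Suc k)
      have "(\<Sum>y\<in>dyadic (Suc k) z. u y) \<le> (\<Sum>y\<in>dyadic J x. u y)"
        using dyadic_mono[OF Suc.prems, of z] dyadic_cong[OF z] u0
        by (intro sum_mono2) (auto simp: dyadic_eq_side_box)
      then have "(\<Sum>y\<in>dyadic (Suc k) z. u y) \<le> K * 2 ^ (N * CARD('d))"
        using K by linarith
      then have "\<bar>average f (dyadic k z) - average f (dyadic (Suc k) z)\<bar> \<le> C * 2 ^ N * \<rho> ^ (N - k)"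
        unfolding C_def \<rho>_def using Suc.prems \<open>J \<le> N\<close> by (intro dyadic_average_step[OF q u]) auto
      moreover have "\<bar>f z - average f (dyadic k z)\<bar> \<le> C * \<rho> / (1 - \<rho>) * 2 ^ N * \<rho> ^ (N - k)"
        using Suc by simp
      ultimately have "\<bar>f z - average f (dyadic (Suc k) z)\<bar>
          \<le> C * \<rho> / (1 - \<rho>) * 2 ^ N * \<rho> ^ (N - k) + C * 2 ^ N * \<rho> ^ (N - k)"
        by linarith
      also have "\<dots> = C / (1 - \<rho>) * 2 ^ N * \<rho> ^ (N - k)"
        using \<rho> by (simp add: field_simps)
      also have "N - k = Suc (N - Suc k)"
        using Suc.prems \<open>J \<le> N\<close> by simp
      finally show ?case
        by (simp add: mult_ac)
    qed
    from this[of J] have "\<bar>f z - average f (dyadic J x)\<bar> \<le> \<rho> * (C / (1 - \<rho>) * 2 ^ N * \<rho> ^ (N - J))"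
      using dyadic_cong[OF z] by (simp add: mult_ac)
    also have "\<dots> \<le> 1 * (C / (1 - \<rho>) * 2 ^ N * \<rho> ^ (N - J))"
      using \<rho> \<open>C \<ge> 0\<close> by (intro mult_right_mono) auto
    finally show ?thesis
      by simp
  qed
  have "\<bar>f x - f x'\<bar> \<le> 2 * (C / (1 - \<rho>) * 2 ^ N * \<rho> ^ (N - J))"
    using main[of x] main[OF x'] by simp
  then show ?thesis
    by (simp add: C_def)
qed

text \<open>Each x is compared with the lower corner of its dyadic cube of level N - l. By the
  Morrey bound this costs at most C \<rho>^l 2^N, uniformly in x. The corners are 2^(N-l) z with z
  in the fixed finite cube of radius 2^l, where the directional limits apply. So l is chosen first,
  from \<epsilon> alone, and N afterwards.\<close>

lemma uniformly_sublinear_of_directional: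
  fixes f u :: "int^'d::finite \<Rightarrow> real" and q K \<epsilon> :: real
  assumes q: "q > real CARD('d)"
    and u: "\<And>y i. \<bar>f (y + axis i 1) - f y\<bar> powr q \<le> u y"
    and K: "\<And>n. (\<Sum>y\<in>cube n 0. u y) \<le> K * (2 * real n + 1) ^ CARD('d)" "K \<ge> 0"
    and dir: "\<And>z. (\<lambda>n. f (int n *s z) / real n) \<longlonglongrightarrow> 0"
    and "\<epsilon> > 0"
  shows "\<forall>\<^sub>F N in sequentially. \<forall>x\<in>cube (2 ^ N) 0. \<bar>f x\<bar> \<le> \<epsilon> * 2 ^ N"
proof -
  define \<rho> where "\<rho> = 2 powr (real CARD('d) / q - 1)"
  have "q > 0"
    using q by (meson less_trans of_nat_0_less_iff zero_less_card_finite)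
  then have "2 powr (real CARD('d) / q - 1) < 2 powr (0::real)"
    using q by (intro powr_less_mono) auto
  then have \<rho>: "0 < \<rho>" "\<rho> < 1"
    by (auto simp: \<rho>_def)
  \<comment> \<open>The Morrey constant with K replaced by K 8^d: the dyadic cubes below lie in the
    cube of radius 2^(N+1), whose side 4 * 2^N + 1 is at most 8 * 2^N.\<close>
  define C where "C = 4 * CARD('d) * (2 ^ CARD('d) + K * 8 ^ CARD('d)) / (1 - \<rho>)"
  have u0: "u y \<ge> 0" for y
    using u[of y undefined] by (meson order_trans powr_ge_zero)
  have "(\<lambda>l. C * \<rho> ^ l) \<longlonglongrightarrow> C * 0"
    using \<rho> by (intro tendsto_intros LIMSEQ_realpow_zero) auto
  then have "\<forall>\<^sub>F l in sequentially. C * \<rho> ^ l < \<epsilon> / 2"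
    using \<open>\<epsilon> > 0\<close> by (intro order_tendstoD(2)) auto
  then obtain l where l: "C * \<rho> ^ l < \<epsilon> / 2"
    by (auto simp: eventually_sequentially)
  have "\<forall>\<^sub>F n in sequentially. \<forall>z\<in>cube (2 ^ l) 0. \<bar>f (int n *s z)\<bar> \<le> \<epsilon> / 2 * real n"
  proof (rule eventually_ball_finite[OF finite_cube], intro ballI)
    fix z :: "int^'d"
    have "\<forall>\<^sub>F n in sequentially. \<bar>f (int n *s z) / real n\<bar> < \<epsilon> / 2"
      using tendstoD[OF dir[of z], of "\<epsilon> / 2"] \<open>\<epsilon> > 0\<close> by simp
    then show "\<forall>\<^sub>F n in sequentially. \<bar>f (int n *s z)\<bar> \<le> \<epsilon> / 2 * real n"
      using eventually_gt_at_top[of 0] by eventually_elim (simp add: field_simps)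
  qed
  then obtain n0 where n0: "\<And>n z. n \<ge> n0 \<Longrightarrow> z \<in> cube (2 ^ l) 0 \<Longrightarrow> \<bar>f (int n *s z)\<bar> \<le> \<epsilon> / 2 * real n"
    by (auto simp: eventually_sequentially)
  show ?thesis
    unfolding eventually_sequentially
  proof (intro exI allI impI ballI)
    fix N and x :: "int^'d"
    assume N: "n0 + l \<le> N" and x: "x \<in> cube (2 ^ N) 0"
    define J where "J = N - l"
    \<comment> \<open>Division rounds down for negative coordinates too, so 2^J z is the lower
      corner of the cube of x and hence lies in it.\<close>
    define z where "z = (\<chi> i. x $ i div 2 ^ J)"
    have J: "J \<le> N" "N - J = l" "N = J + l"
      using N by (auto simp: J_def)
    \<comment> \<open>The directional estimate is used at the scale n = 2^J, not 2^N; the threshold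
      n0 + l makes J \<ge> n0, and n < 2^n does the rest.\<close>
    have "n0 \<le> 2 ^ J"
      using less_exp[of "N - l"] N unfolding J_def by linarith
    have z: "z \<in> cube (2 ^ l) 0"
    proof -
      have "\<bar>x $ i div 2 ^ J\<bar> \<le> 2 ^ l" for i
      proof -
        have "\<bar>x $ i\<bar> \<le> 2 ^ l * 2 ^ J"
          using x J(3) by (simp add: cube_def power_add mult.commute)
        then have "x $ i div 2 ^ J \<le> (2 ^ l * 2 ^ J) div 2 ^ J" "(- (2 ^ l) * 2 ^ J) div 2 ^ J \<le> x $ i div 2 ^ J"
          by (intro zdiv_mono1; simp)+
        then show ?thesis
          by (simp del: mult_minus_left add: abs_le_iff)
      qed
      then show ?thesis
        by (simp add: cube_def z_def)
    qed
    have z_dyadic: "int (2 ^ J) *s z \<in> dyadic J x"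
      by (simp add: dyadic_def z_def vector_scalar_mult_def)
    have "dyadic J x \<subseteq> cube (2 ^ Suc N) 0"
    proof
      fix y
      assume "y \<in> dyadic J x"
      have "\<bar>y $ i\<bar> \<le> 2 ^ Suc N" for i
      proof -
        have "y $ i = x $ i - x $ i mod 2 ^ J + y $ i mod 2 ^ J"
          using \<open>y \<in> dyadic J x\<close> minus_mod_eq_mult_div[of "x $ i" "2 ^ J"] mult_div_mod_eq[of "2 ^ J" "y $ i"]
          by (simp add: dyadic_def)
        moreover have "0 \<le> x $ i mod 2 ^ J" "x $ i mod 2 ^ J < 2 ^ J" "0 \<le> y $ i mod 2 ^ J" "y $ i mod 2 ^ J < 2 ^ J"
          by simp_all
        moreover have "(2::int) ^ J \<le> 2 ^ N"
          using J(1) by simp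
        moreover have "\<bar>x $ i\<bar> \<le> 2 ^ N"
          using x by (simp add: cube_def)
        ultimately show ?thesis
          unfolding power_Suc by linarith
      qed
      then show "y \<in> cube (2 ^ Suc N) 0"
        by (simp add: cube_def)
    qed
    then have "(\<Sum>y\<in>dyadic J x. u y) \<le> (\<Sum>y\<in>cube (2 ^ Suc N) 0. u y)"
      using u0 by (intro sum_mono2) auto
    also have "\<dots> \<le> K * (2 * real (2 ^ Suc N) + 1) ^ CARD('d)"
      by (rule K)
    also have "\<dots> \<le> K * (8 * 2 ^ N) ^ CARD('d)"
    proof (intro mult_left_mono power_mono)
      show "2 * real (2 ^ Suc N) + 1 \<le> 8 * 2 ^ N"
        using one_le_power[of "2::real" N, OF one_le_numeral]
        unfolding power_Suc of_nat_mult of_nat_power of_nat_numeral by linarith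
    qed (use \<open>K \<ge> 0\<close> in auto)
    also have "\<dots> = K * 8 ^ CARD('d) * 2 ^ (N * CARD('d))"
      by (simp add: power_mult_distrib power_mult)
    finally have "\<bar>f x - f (int (2 ^ J) *s z)\<bar> \<le> C * 2 ^ N * \<rho> ^ l"
      using discrete_Morrey[OF q u _ _ J(1) z_dyadic, of "K * 8 ^ CARD('d)"] \<open>K \<ge> 0\<close>
      by (simp add: C_def \<rho>_def J(2))
    also have "\<dots> \<le> \<epsilon> / 2 * 2 ^ N"
      using l by (simp add: mult_ac)
    finally have "\<bar>f x - f (int (2 ^ J) *s z)\<bar> \<le> \<epsilon> / 2 * 2 ^ N" .
    moreover have "\<bar>f (int (2 ^ J) *s z)\<bar> \<le> \<epsilon> / 2 * 2 ^ N"
    proof -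
      have "\<bar>f (int (2 ^ J) *s z)\<bar> \<le> \<epsilon> / 2 * real (2 ^ J)"
        by (rule n0[OF \<open>n0 \<le> 2 ^ J\<close> z])
      also have "\<dots> \<le> \<epsilon> / 2 * 2 ^ N"
        using \<open>\<epsilon> > 0\<close> J(1) by (intro mult_left_mono) auto
      finally show ?thesis .
    qed
    ultimately show "\<bar>f x\<bar> \<le> \<epsilon> * 2 ^ N"
      by linarith
  qed
qed

text \<open>A single term is at most the sum over a cube of radius comparable to n. Hence |h|^q =
  O(n^d) and |h| = O(n^(d/q)), with d/q < 1.\<close>

lemma terms_sublinear_of_cube_averages:
  fixes h u :: "int^'d::finite \<Rightarrow> real" and q K :: real
  assumes q: "q > real CARD('d)"
    and u: "\<And>y. \<bar>h y\<bar> powr q \<le> u y"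
    and K: "\<And>n. (\<Sum>y\<in>cube n 0. u y) \<le> K * (2 * real n + 1) ^ CARD('d)" "K > 0"
  shows "(\<lambda>n. h (int n *s z) / real n) \<longlonglongrightarrow> 0"
proof -
  define d where "d = CARD('d)"
  have u0: "u y \<ge> 0" for y
    using u[of y] by (meson order_trans powr_ge_zero)
  have "q > 0"
    using q by (meson less_trans of_nat_0_less_iff zero_less_card_finite)
  define Z where "Z = nat (\<Sum>i\<in>UNIV. \<bar>z $ i\<bar>)"
  have Z: "int n *s z \<in> cube (n * Z) 0" for n
  proof -
    have "\<bar>z $ i\<bar> \<le> int Z" for i
      unfolding Z_def by (auto simp: sum_nonneg intro: member_le_sum)
    then show ?thesis
      by (auto simp: cube_def abs_mult mult_left_mono)
  qed
  define A where "A = 2 * real Z + 1"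
  have bound: "\<bar>h (int n *s z)\<bar> \<le> (K * A ^ d) powr (1 / q) * real n powr (d / q)" if "n \<ge> 1" for n
  proof -
    have "u (int n *s z) \<le> (\<Sum>y\<in>cube (n * Z) 0. u y)"
      using Z u0 by (intro member_le_sum) auto
    also have "\<dots> \<le> K * (2 * real (n * Z) + 1) ^ d"
      unfolding d_def by (rule K)
    also have "\<dots> \<le> K * (A * real n) ^ d"
      using K(2) that by (intro mult_left_mono power_mono) (auto simp: A_def algebra_simps)
    finally have "\<bar>h (int n *s z)\<bar> powr q \<le> K * A ^ d * real n ^ d"
      using u[of "int n *s z"] by (simp add: power_mult_distrib)
    then have "(\<bar>h (int n *s z)\<bar> powr q) powr (1 / q) \<le> (K * A ^ d * real n ^ d) powr (1 / q)"
      using \<open>q > 0\<close> by (intro powr_mono2) auto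
    then show ?thesis
      using \<open>q > 0\<close> that K(2) by (simp add: powr_powr powr_mult A_def flip: powr_realpow)
  qed
  have "(\<lambda>n. (K * A ^ d) powr (1 / q) * real n powr (d / q - 1)) \<longlonglongrightarrow> (K * A ^ d) powr (1 / q) * 0"
    using q \<open>q > 0\<close> by (intro tendsto_intros tendsto_neg_powr filterlim_real_sequentially) (auto simp: d_def)
  then have lim: "(\<lambda>n. (K * A ^ d) powr (1 / q) * real n powr (d / q - 1)) \<longlonglongrightarrow> 0"
    by simp
  show ?thesis
  proof (rule Lim_null_comparison[OF _ lim])
    show "\<forall>\<^sub>F n in sequentially. norm (h (int n *s z) / real n) \<le> (K * A ^ d) powr (1 / q) * real n powr (d / q - 1)"
      using eventually_ge_at_top[of 1]
      by eventually_elim (use bound in \<open>simp add: powr_diff divide_right_mono\<close>)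
  qed
qed

section \<open>Correctors and the maximal ergodic inequality\<close>

lemma walkpos_simps [simp]:
  "walkpos es 0 = 0"
  "walkpos (e # es) (Suc k) = e + walkpos es k"
  by (simp_all add: walkpos_def)

lemma exists_nbr_path: "\<exists>es. set es \<subseteq> nbrs \<and> sum_list es = (x :: int^'d::finite)"
proof -
  define R where "R = {sum_list es |es. set es \<subseteq> (nbrs :: (int^'d) set)}"
  have R_add: "x + y \<in> R" if xy: "x \<in> R" "y \<in> R" for x y
  proof -
    obtain es es' where "set es \<subseteq> nbrs" "sum_list es = x" "set es' \<subseteq> nbrs" "sum_list es' = y"
      using xy unfolding R_def by blast
    then have "set (es @ es') \<subseteq> nbrs" "sum_list (es @ es') = x + y"
      by auto
    then show ?thesis
      unfolding R_def by (intro CollectI exI[of _ "es @ es'"]) simp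
  qed
  have R_0: "0 \<in> R"
    unfolding R_def by (rule CollectI, rule exI[of _ "[]"]) simp
  have R_nbr: "e \<in> R" if "e \<in> nbrs" for e
    unfolding R_def by (rule CollectI, rule exI[of _ "[e]"]) (simp add: that)
  have R_axis: "axis i k \<in> R" for i and k :: int
  proof (induction k rule: int_induct[where k = 0])
    case base
    have "(axis i 0 :: int^'d) = 0"
      by (simp add: axis_def vec_eq_iff)
    with R_0 show ?case
      by (simp only:)
  next
    case (step1 k)
    have "axis i (k + 1) = axis i k + (axis i 1 :: int^'d)"
      by (simp add: axis_def vec_eq_iff)
    then show ?case
      using step1 R_add R_nbr by simp
  next
    case (step2 k)
    have "axis i (k - 1) = axis i k + (- axis i 1 :: int^'d)"
      by (simp add: axis_def vec_eq_iff)
    then show ?case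
      using step2.IH R_add[of "axis i k" "- axis i 1"] R_nbr[of "- axis i 1"] by simp
  qed
  have "(\<Sum>i\<in>S. axis i (x $ i)) \<in> R" for S
    using finite[of S] by (induction S) (auto simp: R_0 R_axis R_add)
  moreover have "(\<Sum>i\<in>UNIV. axis i (x $ i)) = x"
    by (simp add: vec_eq_iff axis_def if_distrib cong: if_cong)
  ultimately have "x \<in> R"
    by metis
  then show ?thesis
    by (auto simp: R_def)
qed

text \<open>The path depends on x only, never on \<omega>. The corrector at x is therefore a fixed
  finite sum of shifted values of \<open>F\<close>, measurable and integrable with mean 0, without
  reference to the null set where closedness fails.\<close>

definition nbr_path :: "int^'d::finite \<Rightarrow> (int^'d) list" where
  "nbr_path x = (SOME es. set es \<subseteq> nbrs \<and> sum_list es = x)"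

lemma nbr_path: "set (nbr_path x) \<subseteq> nbrs" "sum_list (nbr_path x) = x"
  using someI_ex[OF exists_nbr_path[of x]] by (auto simp: nbr_path_def)

primrec path_sum ::
  "(int^'d::finite \<Rightarrow> 'w \<Rightarrow> 'w) \<Rightarrow> ('w \<Rightarrow> int^'d \<Rightarrow> real) \<Rightarrow> 'w \<Rightarrow> int^'d \<Rightarrow> (int^'d) list \<Rightarrow> real" where
  "path_sum T F \<omega> x [] = 0"
| "path_sum T F \<omega> x (e # es) = F (Tshift T x \<omega>) e + path_sum T F \<omega> (x + e) es"

lemma path_sum_eq:
  "path_sum T F \<omega> x es = (\<Sum>i<length es. F (Tshift T (x + walkpos es i) \<omega>) (es ! i))"
proof (induction es arbitrary: x)
  case (Cons e es)
  then show ?case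
    by (simp add: sum.lessThan_Suc_shift add.assoc del: sum.lessThan_Suc)
qed simp

lemma path_sum_append:
  "path_sum T F \<omega> x (es @ es') = path_sum T F \<omega> x es + path_sum T F \<omega> (x + sum_list es) es'"
  by (induction es arbitrary: x) (auto simp: add.assoc)

lemma path_sum_uminus: "path_sum T (\<lambda>\<omega> e. - F \<omega> e) \<omega> x es = - path_sum T F \<omega> x es"
  by (induction es arbitrary: x) auto

text \<open>The loop condition of \<open>classK\<close> recast in terms of a starting point and a
  list of steps. The free starting point makes it stable under shifts of \<omega>.\<close>

definition closed_form :: "(int^'d::finite \<Rightarrow> 'w \<Rightarrow> 'w) \<Rightarrow> ('w \<Rightarrow> int^'d \<Rightarrow> real) \<Rightarrow> 'w \<Rightarrow> bool" where
  "closed_form T F \<omega> \<longleftrightarrow> (\<forall>x es. set es \<subseteq> nbrs \<and> sum_list es = 0 \<longrightarrow> path_sum T F \<omega> x es = 0)"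

definition corrector :: "(int^'d::finite \<Rightarrow> 'w \<Rightarrow> 'w) \<Rightarrow> ('w \<Rightarrow> int^'d \<Rightarrow> real) \<Rightarrow> 'w \<Rightarrow> int^'d \<Rightarrow> real" where
  "corrector T F \<omega> x = path_sum T F \<omega> 0 (nbr_path x)"

lemma corrector_uminus: "corrector T (\<lambda>\<omega> e. - F \<omega> e) \<omega> x = - corrector T F \<omega> x"
  by (simp add: corrector_def path_sum_uminus)

text \<open>Both paths are closed up by the same return path.\<close>

lemma path_sum_unique:
  assumes "closed_form T F \<omega>" "set es \<subseteq> nbrs" "set es' \<subseteq> nbrs" "sum_list es = sum_list es'"
  shows "path_sum T F \<omega> x es = path_sum T F \<omega> x es'"
proof -
  define r where "r = nbr_path (- sum_list es)"
  have "path_sum T F \<omega> x (es @ r) = 0" "path_sum T F \<omega> x (es' @ r) = 0"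
    using assms nbr_path[of "- sum_list es"] by (auto simp: closed_form_def r_def)
  then show ?thesis
    using assms(4) by (simp add: path_sum_append)
qed

lemma path_sum_corrector:
  assumes "closed_form T F \<omega>" "set es \<subseteq> nbrs"
  shows "path_sum T F \<omega> x es = corrector T F \<omega> (x + sum_list es) - corrector T F \<omega> x"
proof -
  have "path_sum T F \<omega> 0 (nbr_path x @ es) = corrector T F \<omega> (x + sum_list es)"
    unfolding corrector_def using assms
    by (intro path_sum_unique) (simp_all add: nbr_path)
  then show ?thesis
    by (simp add: path_sum_append corrector_def nbr_path)
qed

lemma corrector_step:
  assumes "closed_form T F \<omega>" "e \<in> nbrs"
  shows "corrector T F \<omega> (x + e) = corrector T F \<omega> x + F (Tshift T x \<omega>) e"
  using path_sum_corrector[OF assms(1), of "[e]" x] assms(2) by simp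

lemma corrector_0:
  assumes "closed_form T F \<omega>"
  shows "corrector T F \<omega> 0 = 0"
  using assms nbr_path[of 0] unfolding corrector_def closed_form_def by blast

lemma classK_AE_closed_form:
  fixes T :: "int^'d::finite \<Rightarrow> 'w \<Rightarrow> 'w"
  assumes "F \<in> classK M T"
  shows "AE \<omega> in M. closed_form T F \<omega>"
proof -
  have "AE \<omega> in M. \<forall>xs n. length xs = Suc n \<and> xs ! 0 = xs ! n \<and> (\<forall>i<n. xs ! Suc i - xs ! i \<in> nbrs) \<longrightarrow>
        (\<Sum>i<n. F (Tshift T (xs ! i) \<omega>) (xs ! Suc i - xs ! i)) = 0"
    using assms by (simp add: classK_def)
  then show ?thesis
  proof (rule AE_mp, intro AE_I2 impI)
    fix \<omega>
    assume closed: "\<forall>xs n. length xs = Suc n \<and> xs ! 0 = xs ! n \<and> (\<forall>i<n. xs ! Suc i - xs ! i \<in> nbrs) \<longrightarrow>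
        (\<Sum>i<n. F (Tshift T (xs ! i) \<omega>) (xs ! Suc i - xs ! i)) = 0"
    show "closed_form T F \<omega>"
      unfolding closed_form_def
    proof (intro allI impI, elim conjE)
      fix x and es :: "(int^'d) list"
      assume es: "set es \<subseteq> nbrs" "sum_list es = 0"
      define n where "n = length es"
      define xs where "xs = map (\<lambda>k. x + walkpos es k) [0..<Suc n]"
      have nth: "xs ! k = x + walkpos es k" if "k \<le> n" for k
        using that by (simp add: xs_def nth_append del: upt_Suc)
      have diff: "xs ! Suc i - xs ! i = es ! i" if "i < n" for i
        using that nth[of i] nth[of "Suc i"] by (simp add: walkpos_def take_Suc_conv_app_nth n_def)
      have "length xs = Suc n"
        by (simp add: xs_def)
      moreover have "xs ! 0 = xs ! n"
        using es nth[of 0] nth[of n] by (simp add: walkpos_def n_def)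
      moreover have "\<forall>i<n. xs ! Suc i - xs ! i \<in> nbrs"
        using diff es by (auto simp: n_def)
      ultimately have "(\<Sum>i<n. F (Tshift T (xs ! i) \<omega>) (xs ! Suc i - xs ! i)) = 0"
        using closed by blast
      also have "(\<Sum>i<n. F (Tshift T (xs ! i) \<omega>) (xs ! Suc i - xs ! i)) = path_sum T F \<omega> x es"
        unfolding path_sum_eq n_def[symmetric] by (intro sum.cong refl) (simp only: lessThan_iff diff, simp only: nth[OF less_imp_le])
      finally show "path_sum T F \<omega> x es = 0" .
    qed
  qed
qed

lemma classK_uminus:
  assumes "F \<in> classK M T"
  shows "(\<lambda>\<omega> e. - F \<omega> e) \<in> classK M T"
  using assms by (auto simp: classK_def sum_negf)

section \<open>Garsia's maximal ergodic inequality\<close>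

context prob_space
begin

text \<open>For H = max of s 0, ..., s N one has H \<le> \<phi> + H o S where H > 0, and H = 0 \<le>
  H o S elsewhere; integrating cancels H against H o S. The recursion is assumed only almost surely,
  as correctors are additive only there, whereas \<open>s0\<close> holds everywhere because H \<ge>
  0 is evaluated at \<open>S \<omega>\<close>.\<close>

lemma maximal_ergodic:
  fixes s :: "nat \<Rightarrow> 'a \<Rightarrow> real" and \<phi> :: "'a \<Rightarrow> real"
  assumes S: "S \<in> M \<rightarrow>\<^sub>M M" "distr M M S = M"
    and int: "integrable M \<phi>" "\<And>n. integrable M (s n)"
    and s0: "\<And>\<omega>. \<omega> \<in> space M \<Longrightarrow> s 0 \<omega> = 0"
    and rec: "AE \<omega> in M. \<forall>n. s (Suc n) \<omega> = \<phi> \<omega> + s n (S \<omega>)"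
  shows "0 \<le> (\<integral>\<omega>. indicator {\<omega> \<in> space M. \<exists>n\<le>N. s n \<omega> > 0} \<omega> * \<phi> \<omega> \<partial>M)"
proof -
  note [measurable] = S(1)
  define H where "H = (\<lambda>\<omega>. MAX n\<in>{..N}. s n \<omega>)"
  define E where "E = {\<omega> \<in> space M. \<exists>n\<le>N. s n \<omega> > 0}"
  have [measurable]: "s n \<in> borel_measurable M" for n
    using int by simp
  have [measurable]: "E \<in> sets M"
    unfolding E_def by measurable
  have H: "integrable M H"
    unfolding H_def by (rule integrable_MAX) (auto simp: int)
  have HS: "integrable M (\<lambda>\<omega>. H (S \<omega>))"
    using integrable_distr[OF S(1), of H] H S(2) by simp
  have H_ge: "s n \<omega> \<le> H \<omega>" if "n \<le> N" for n \<omega>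
    unfolding H_def using that by (intro Max_ge) auto
  have H_nonneg: "0 \<le> H \<omega>" if "\<omega> \<in> space M" for \<omega>
    using H_ge[of 0 \<omega>] s0[OF that] by simp
  have "(\<integral>\<omega>. H \<omega> - H (S \<omega>) \<partial>M) \<le> (\<integral>\<omega>. indicator E \<omega> * \<phi> \<omega> \<partial>M)"
  proof (rule integral_mono_AE)
    show "integrable M (\<lambda>\<omega>. indicator E \<omega> * \<phi> \<omega>)"
      using integrable_real_mult_indicator[OF _ int(1), of E] by (simp add: mult.commute)
    show "AE \<omega> in M. H \<omega> - H (S \<omega>) \<le> indicator E \<omega> * \<phi> \<omega>"
      using rec
    proof (rule AE_mp, intro AE_I2 impI)
      fix \<omega>
      assume \<omega>: "\<omega> \<in> space M" and rec: "\<forall>n. s (Suc n) \<omega> = \<phi> \<omega> + s n (S \<omega>)"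
      have S\<omega>: "S \<omega> \<in> space M"
        using \<omega> S(1) measurable_space by metis
      have "H \<omega> \<in> (\<lambda>n. s n \<omega>) ` {..N}"
        unfolding H_def by (rule Max_in) auto
      then obtain n where n: "n \<le> N" "H \<omega> = s n \<omega>"
        by auto
      show "H \<omega> - H (S \<omega>) \<le> indicator E \<omega> * \<phi> \<omega>"
      proof (cases "\<omega> \<in> E")
        case True
        then obtain k where "k \<le> N" "s k \<omega> > 0"
          by (auto simp: E_def)
        then have "s n \<omega> > 0"
          using H_ge[of k \<omega>] n by simp
        \<comment> \<open>A positive maximum is not attained at index 0, so the recursion applies,
          and m stays within the range of the maximum.\<close>
        then obtain m where m: "n = Suc m"
          using s0[OF \<omega>] by (cases n) auto
        then have "H \<omega> = \<phi> \<omega> + s m (S \<omega>)"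
          using rec n by simp
        also have "\<dots> \<le> \<phi> \<omega> + H (S \<omega>)"
          using H_ge[of m "S \<omega>"] m n by simp
        finally show ?thesis
          using True by simp
      next
        case False
        then have "H \<omega> \<le> 0"
          using \<omega> n by (auto simp: E_def not_less)
        then show ?thesis
          using False H_nonneg[OF S\<omega>] by simp
      qed
    qed
  qed (use H HS in auto)
  moreover have "(\<integral>\<omega>. H (S \<omega>) \<partial>M) = (\<integral>\<omega>. H \<omega> \<partial>M)"
    using integral_distr[OF S(1), of H] S(2) H by simp
  ultimately show ?thesis
    using H HS by (simp add: E_def)
qed

text \<open>The events \<open>E N\<close> increase to one of full probability, and |\<phi>|
  dominates.\<close>

lemma maximal_ergodic_AE_positive:
  fixes s :: "nat \<Rightarrow> 'a \<Rightarrow> real" and \<phi> :: "'a \<Rightarrow> real"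
  assumes S: "S \<in> M \<rightarrow>\<^sub>M M" "distr M M S = M"
    and int: "integrable M \<phi>" "\<And>n. integrable M (s n)"
    and s0: "\<And>\<omega>. \<omega> \<in> space M \<Longrightarrow> s 0 \<omega> = 0"
    and rec: "AE \<omega> in M. \<forall>n. s (Suc n) \<omega> = \<phi> \<omega> + s n (S \<omega>)"
    and pos: "AE \<omega> in M. \<exists>n. s n \<omega> > 0"
  shows "0 \<le> expectation \<phi>"
proof -
  define E where "E = (\<lambda>N. {\<omega> \<in> space M. \<exists>n\<le>N. s n \<omega> > 0})"
  have [measurable]: "s n \<in> borel_measurable M" "\<phi> \<in> borel_measurable M" for n
    using int by simp_all
  have [measurable]: "E N \<in> sets M" for N
    unfolding E_def by measurable
  have "(\<lambda>N. \<integral>\<omega>. indicator (E N) \<omega> * \<phi> \<omega> \<partial>M) \<longlonglongrightarrow> expectation \<phi>"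
  proof (rule integral_dominated_convergence)
    show "integrable M (\<lambda>\<omega>. \<bar>\<phi> \<omega>\<bar>)"
      using int by simp
    show "AE \<omega> in M. (\<lambda>N. indicator (E N) \<omega> * \<phi> \<omega>) \<longlonglongrightarrow> \<phi> \<omega>"
      using pos
    proof (rule AE_mp, intro AE_I2 impI)
      fix \<omega>
      assume "\<omega> \<in> space M" "\<exists>n. s n \<omega> > 0"
      then obtain n where "s n \<omega> > 0"
        by blast
      then have "\<omega> \<in> E N" if "n \<le> N" for N
        using that \<open>\<omega> \<in> space M\<close> by (auto simp: E_def)
      then have "\<forall>\<^sub>F N in sequentially. indicator (E N) \<omega> * \<phi> \<omega> = \<phi> \<omega>"
        by (auto simp: eventually_sequentially intro!: exI[of _ n])
      then show "(\<lambda>N. indicator (E N) \<omega> * \<phi> \<omega>) \<longlonglongrightarrow> \<phi> \<omega>"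
        by (rule tendsto_eventually)
    qed
    show "AE \<omega> in M. norm (indicator (E N) \<omega> * \<phi> \<omega>) \<le> \<bar>\<phi> \<omega>\<bar>" for N
      by (auto simp: indicator_def)
  qed auto
  moreover have "0 \<le> (\<integral>\<omega>. indicator (E N) \<omega> * \<phi> \<omega> \<partial>M)" for N
    unfolding E_def by (rule maximal_ergodic[OF S int s0 rec])
  ultimately show ?thesis
    by (intro LIMSEQ_le_const) auto
qed

end

section \<open>Sublinearity of correctors\<close>

context lattice_action
begin

lemma classK_moment:
  assumes "F \<in> classK M T"
  obtains q where "q > real CARD('d)" "\<forall>e\<in>nbrs. integrable M (\<lambda>\<omega>. \<bar>F \<omega> e\<bar> powr q)"
proof -
  obtain \<alpha> where "\<alpha> > 0" "\<forall>e\<in>nbrs. integrable M (\<lambda>\<omega>. \<bar>F \<omega> e\<bar> powr (real CARD('d) + \<alpha>))"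
    using assms by (auto simp: classK_def)
  then show ?thesis
    by (intro that[of "real CARD('d) + \<alpha>"]) auto
qed

lemma classK_measurable: "F \<in> classK M T \<Longrightarrow> e \<in> nbrs \<Longrightarrow> (\<lambda>\<omega>. F \<omega> e) \<in> borel_measurable M"
  by (simp add: classK_def)

lemma classK_expectation: "F \<in> classK M T \<Longrightarrow> e \<in> nbrs \<Longrightarrow> expectation (\<lambda>\<omega>. F \<omega> e) = 0"
  by (simp add: classK_def)

lemma classK_integrable:
  assumes F: "F \<in> classK M T" and e: "e \<in> nbrs"
  shows "integrable M (\<lambda>\<omega>. F \<omega> e)"
proof -
  obtain q where q: "q > real CARD('d)" "integrable M (\<lambda>\<omega>. \<bar>F \<omega> e\<bar> powr q)"
    using classK_moment[OF F] e by metis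
  have "real CARD('d) \<ge> 1"
    by (simp add: Suc_leI)
  then have "q \<ge> 1"
    using q(1) by linarith
  show ?thesis
  proof (rule Bochner_Integration.integrable_bound)
    show "integrable M (\<lambda>\<omega>. 1 + \<bar>F \<omega> e\<bar> powr q)"
      using q by simp
    show "AE \<omega> in M. norm (F \<omega> e) \<le> norm (1 + \<bar>F \<omega> e\<bar> powr q)"
      using Young_linear[of "\<bar>F _ e\<bar>" 1 q] \<open>q \<ge> 1\<close> by (intro AE_I2) simp
  qed (rule classK_measurable[OF F e])
qed

lemma path_sum_integrable:
  assumes F: "F \<in> classK M T" and "set es \<subseteq> nbrs"
  shows "integrable M (\<lambda>\<omega>. path_sum T F \<omega> x es) \<and> expectation (\<lambda>\<omega>. path_sum T F \<omega> x es) = 0"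
  using assms(2)
proof (induction es arbitrary: x)
  case (Cons e es)
  then have e: "e \<in> nbrs"
    by simp
  then show ?case
    using Cons integrable_Tshift[OF classK_integrable[OF F e], of x]
      integral_Tshift[OF classK_measurable[OF F e], of x] classK_expectation[OF F e]
    by simp
qed simp

lemma corrector_integrable:
  assumes "F \<in> classK M T"
  shows "integrable M (\<lambda>\<omega>. corrector T F \<omega> x)" "expectation (\<lambda>\<omega>. corrector T F \<omega> x) = 0"
  unfolding corrector_def using path_sum_integrable[OF assms nbr_path(1)] by auto

lemma path_sum_Tshift:
  assumes "\<omega> \<in> space M"
  shows "path_sum T F (Tshift T y \<omega>) x es = path_sum T F \<omega> (y + x) es"
  using assms by (induction es arbitrary: x) (auto simp: add.assoc add.commute[of y] simp flip: Tshift_add)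

lemma closed_form_Tshift:
  "\<omega> \<in> space M \<Longrightarrow> closed_form T F \<omega> \<Longrightarrow> closed_form T F (Tshift T y \<omega>)"
  by (simp add: closed_form_def path_sum_Tshift)

lemma corrector_add:
  assumes "\<omega> \<in> space M" "closed_form T F \<omega>"
  shows "corrector T F \<omega> (x + y) = corrector T F \<omega> x + corrector T F (Tshift T x \<omega>) y"
proof -
  have "corrector T F (Tshift T x \<omega>) y = path_sum T F \<omega> x (nbr_path y)"
    using path_sum_Tshift[OF assms(1), of F x 0] by (simp add: corrector_def)
  also have "\<dots> = corrector T F \<omega> (x + y) - corrector T F \<omega> x"
    using path_sum_corrector[OF assms(2) nbr_path(1)] by (simp add: nbr_path)
  finally show ?thesis
    by simp
qed

text \<open>One integrable function dominating the increments in all directions at once, in the role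
  of \<open>u\<close> in the Morrey estimate.\<close>

definition power_sum :: "('w \<Rightarrow> int^'d \<Rightarrow> real) \<Rightarrow> real \<Rightarrow> 'w \<Rightarrow> real" where
  "power_sum F q \<omega> = (\<Sum>e\<in>nbrs. \<bar>F \<omega> e\<bar> powr q)"

lemma power_sum_ge: "e \<in> nbrs \<Longrightarrow> \<bar>F \<omega> e\<bar> powr q \<le> power_sum F q \<omega>"
  unfolding power_sum_def by (intro member_le_sum) auto

lemma AE_power_sum_cube_averages:
  assumes F: "F \<in> classK M T" and q: "\<forall>e\<in>nbrs. integrable M (\<lambda>\<omega>. \<bar>F \<omega> e\<bar> powr q)"
  shows "AE \<omega> in M. \<exists>K>0. \<forall>n. (\<Sum>y\<in>cube n 0. power_sum F q (Tshift T y \<omega>)) \<le> K * (2 * real n + 1) ^ CARD('d)"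
  using q by (intro AE_bounded_cube_averages) (auto simp: power_sum_def sum_nonneg)

lemma AE_terms_sublinear:
  assumes F: "F \<in> classK M T"
  shows "AE \<omega> in M. \<forall>e\<in>nbrs. \<forall>z. (\<lambda>n. F (Tshift T (int n *s z) \<omega>) e / real n) \<longlonglongrightarrow> 0"
proof -
  obtain q where q: "q > real CARD('d)" "\<forall>e\<in>nbrs. integrable M (\<lambda>\<omega>. \<bar>F \<omega> e\<bar> powr q)"
    using classK_moment[OF F] by metis
  show ?thesis
    using AE_power_sum_cube_averages[OF F q(2)]
  proof (rule AE_mp, intro AE_I2 impI ballI allI)
    fix \<omega> and e z :: "int^'d"
    assume "e \<in> nbrs" and "\<exists>K>0. \<forall>n. (\<Sum>y\<in>cube n 0. power_sum F q (Tshift T y \<omega>)) \<le> K * (2 * real n + 1) ^ CARD('d)"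
    then obtain K where "K > 0" "\<And>n. (\<Sum>y\<in>cube n 0. power_sum F q (Tshift T y \<omega>)) \<le> K * (2 * real n + 1) ^ CARD('d)"
      by blast
    then show "(\<lambda>n. F (Tshift T (int n *s z) \<omega>) e / real n) \<longlonglongrightarrow> 0"
      using terms_sublinear_of_cube_averages[OF q(1), of "\<lambda>y. F (Tshift T y \<omega>) e" "\<lambda>y. power_sum F q (Tshift T y \<omega>)" K z]
        power_sum_ge[OF \<open>e \<in> nbrs\<close>] by blast
  qed
qed

text \<open>An extended-real upper limit, since neither existence nor finiteness of the limit is
  known at this point.\<close>

definition slope :: "('w \<Rightarrow> int^'d \<Rightarrow> real) \<Rightarrow> int^'d \<Rightarrow> 'w \<Rightarrow> ereal" where
  "slope F z \<omega> = limsup (\<lambda>n. ereal (corrector T F \<omega> (int n *s z) / real n))"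

lemma slope_measurable [measurable]:
  assumes "F \<in> classK M T"
  shows "slope F z \<in> borel_measurable M"
proof -
  have [measurable]: "(\<lambda>\<omega>. corrector T F \<omega> x) \<in> borel_measurable M" for x
    using corrector_integrable(1)[OF assms] by auto
  show ?thesis
    unfolding slope_def by measurable
qed

text \<open>The corrector at e + x can be computed through e or through x. Comparing the two routes,
  the corrector seen from T_e \<omega> differs from the original one at x by F(T_x \<omega>, e) -
  F(\<omega>, e), which is o(n) for x = n z.\<close>

lemma slope_invariant:
  assumes \<omega>: "\<omega> \<in> space M" "closed_form T F \<omega>" and e: "e \<in> nbrs"
    and sub: "(\<lambda>n. F (Tshift T (int n *s z) \<omega>) e / real n) \<longlonglongrightarrow> 0"
  shows "slope F z (Tshift T e \<omega>) = slope F z \<omega>"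
proof -
  define c where "c = (\<lambda>n. F (Tshift T (int n *s z) \<omega>) e / real n - F \<omega> e * inverse (real n))"
  have "c \<longlonglongrightarrow> 0 - F \<omega> e * 0"
    unfolding c_def by (intro tendsto_diff sub tendsto_mult tendsto_const lim_inverse_n)
  then have c: "(\<lambda>n. ereal (c n)) \<longlonglongrightarrow> 0"
    by (simp add: zero_ereal_def)
  have "corrector T F (Tshift T e \<omega>) x = F (Tshift T x \<omega>) e - F \<omega> e + corrector T F \<omega> x" for x
  proof -
    have "corrector T F \<omega> e = F \<omega> e"
      using corrector_step[OF \<omega>(2) e, of 0] corrector_0[OF \<omega>(2)] by simp
    then show ?thesis
      using corrector_add[OF \<omega>, of e x] corrector_step[OF \<omega>(2) e, of x] by (simp add: add.commute)
  qed
  then have "corrector T F (Tshift T e \<omega>) (int n *s z) / real n = c n + corrector T F \<omega> (int n *s z) / real n" for n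
    unfolding c_def by (simp only:) (simp add: divide_inverse algebra_simps)
  then have "slope F z (Tshift T e \<omega>) = limsup (\<lambda>n. ereal (c n) + ereal (corrector T F \<omega> (int n *s z) / real n))"
    unfolding slope_def by simp
  also have "\<dots> = 0 + slope F z \<omega>"
    unfolding slope_def by (rule ereal_limsup_lim_add[OF c]) simp
  finally show ?thesis
    by simp
qed

lemma AE_slope_invariant:
  assumes F: "F \<in> classK M T"
  shows "AE \<omega> in M. \<forall>x. slope F z (Tshift T x \<omega>) = slope F z \<omega>"
proof -
  have "AE \<omega> in M. \<forall>e\<in>nbrs. slope F z (Tshift T e \<omega>) = slope F z \<omega>"
    using classK_AE_closed_form[OF F] AE_terms_sublinear[OF F] AE_space
    by eventually_elim (auto intro: slope_invariant)
  \<comment> \<open>Invariance under one step must hold at every point of the orbit before it can be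
    iterated along a path.\<close>
  from AE_all_Tshift[OF this] show ?thesis
  proof (rule AE_mp, intro AE_I2 impI allI)
    fix \<omega> x
    assume \<omega>: "\<omega> \<in> space M"
      and inv: "\<forall>x. \<forall>e\<in>nbrs. slope F z (Tshift T e (Tshift T x \<omega>)) = slope F z (Tshift T x \<omega>)"
    have "slope F z (Tshift T (sum_list es) \<omega>) = slope F z \<omega>" if "set es \<subseteq> nbrs" for es
      using that
    proof (induction es)
      case (Cons e es)
      then show ?case
        using inv \<omega> by (simp add: Tshift_add)
    qed simp
    from this[OF nbr_path(1), of x] show "slope F z (Tshift T x \<omega>) = slope F z \<omega>"
      by (simp add: nbr_path)
  qed
qed

text \<open>If the slope exceeded c almost surely, the sums of
  \<open>corrector T F \<omega> z - c\<close> along the orbit of \<open>Tshift T z\<close> would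
  almost surely become positive. The maximal ergodic inequality would then make the mean, which is
  -c, nonnegative.\<close>

lemma not_AE_slope_greater:
  assumes F: "F \<in> classK M T" and "c > 0"
  shows "\<not> (AE \<omega> in M. slope F z \<omega> > ereal c)"
proof
  assume AE: "AE \<omega> in M. slope F z \<omega> > ereal c"
  define \<phi> where "\<phi> = (\<lambda>\<omega>. corrector T F \<omega> z - c)"
  \<comment> \<open>The case split makes \<open>s 0\<close> vanish everywhere, as Garsia's
    inequality demands; \<open>nbr_path 0\<close> is merely some loop, so the corrector at 0
    vanishes only where the form is closed.\<close>
  define s where "s = (\<lambda>n \<omega>. if n = 0 then 0 else corrector T F \<omega> (int n *s z) - c * real n)"
  have "0 \<le> expectation \<phi>"
  proof (rule maximal_ergodic_AE_positive[of "Tshift T z" \<phi> s])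
    show "integrable M \<phi>" "integrable M (s n)" for n
      using corrector_integrable(1)[OF F] by (cases "n = 0"; simp add: \<phi>_def s_def)+
    show "AE \<omega> in M. \<forall>n. s (Suc n) \<omega> = \<phi> \<omega> + s n (Tshift T z \<omega>)"
      using classK_AE_closed_form[OF F] AE_space
    proof eventually_elim
      case (elim \<omega>)
      have "int (Suc n) *s z = z + int n *s z" for n
        by (simp add: vec_eq_iff algebra_simps)
      then have "corrector T F \<omega> (int (Suc n) *s z) = corrector T F \<omega> z + corrector T F (Tshift T z \<omega>) (int n *s z)" for n
        using corrector_add[OF elim(2,1)] by (simp only:)
      moreover have "corrector T F (Tshift T z \<omega>) (int 0 *s z) = 0"
        using elim by (simp add: corrector_0 closed_form_Tshift)
      ultimately show ?case
        by (auto simp: s_def \<phi>_def distrib_left simp del: of_nat_Suc)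
           (simp_all add: algebra_simps)
    qed
    show "AE \<omega> in M. \<exists>n. s n \<omega> > 0"
      using AE
    proof eventually_elim
      case (elim \<omega>)
      have "\<not> (\<forall>\<^sub>F n in sequentially. ereal (corrector T F \<omega> (int n *s z) / real n) \<le> ereal c)"
        using elim Limsup_bounded[of "\<lambda>n. ereal (corrector T F \<omega> (int n *s z) / real n)" "ereal c" sequentially]
        by (auto simp: slope_def)
      then have "\<not> (\<forall>n\<ge>1. corrector T F \<omega> (int n *s z) / real n \<le> c)"
        unfolding eventually_sequentially by auto
      then obtain n where "n \<ge> 1" "corrector T F \<omega> (int n *s z) / real n > c"
        by (auto simp: not_le)
      then have "s n \<omega> > 0"
        by (simp add: s_def field_simps)
      then show ?case ..
    qed
  qed (auto simp: s_def Tshift_pres)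
  moreover have "expectation \<phi> = - c"
    using corrector_integrable[OF F, of z] by (simp add: \<phi>_def prob_space)
  ultimately show False
    using \<open>c > 0\<close> by simp
qed

end

section \<open>Consequences of ergodicity\<close>

locale ergodic_lattice_action = lattice_action +
  assumes ergodic: "\<And>A. A \<in> sets M \<Longrightarrow> (\<forall>e\<in>nbrs. T e -` A \<inter> space M = A) \<Longrightarrow>
                   measure M A = 0 \<or> measure M A = 1"
begin

text \<open>The ergodicity hypothesis speaks of strictly invariant events. The set of points whose
  whole orbit lies in \<open>A\<close> is strictly invariant, measurable because the lattice is
  countable, and almost surely equal to \<open>A\<close>.\<close>

lemma ergodic_zero_one:
  assumes A: "A \<in> sets M" and inv: "AE \<omega> in M. \<forall>x. Tshift T x \<omega> \<in> A \<longleftrightarrow> \<omega> \<in> A"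
  shows "(AE \<omega> in M. \<omega> \<notin> A) \<or> (AE \<omega> in M. \<omega> \<in> A)"
proof -
  note [measurable] = A
  define B where "B = {\<omega> \<in> space M. \<forall>x. Tshift T x \<omega> \<in> A}"
  have [measurable]: "B \<in> sets M"
    unfolding B_def by measurable
  have "T e -` B \<inter> space M = B" if e: "e \<in> nbrs" for e
  proof -
    have "(\<forall>x. Tshift T x (T e \<omega>) \<in> A) \<longleftrightarrow> (\<forall>x. Tshift T x \<omega> \<in> A)" if \<omega>: "\<omega> \<in> space M" for \<omega>
    proof -
      have "Tshift T x (T e \<omega>) = Tshift T (x + e) \<omega>" for x
        using \<omega> e by (simp add: Tshift_add Tshift_nbr)
      then show ?thesis
        by (metis diff_add_cancel)
    qed
    then show ?thesis
      using T_space[OF e] by (auto simp: B_def)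
  qed
  then have B: "prob B = 0 \<or> prob B = 1"
    by (intro ergodic) auto
  have AB: "AE \<omega> in M. \<omega> \<in> B \<longleftrightarrow> \<omega> \<in> A"
    using inv AE_space by eventually_elim (auto simp: B_def)
  from B show ?thesis
  proof
    assume "prob B = 0"
    then have "AE \<omega> in M. \<omega> \<notin> B"
      by (intro AE_not_in null_setsI) (auto simp: emeasure_eq_measure)
    with AB have "AE \<omega> in M. \<omega> \<notin> A"
      by eventually_elim auto
    then show ?thesis ..
  next
    assume "prob B = 1"
    then have "AE \<omega> in M. \<omega> \<in> B"
      by (intro AE_prob_1)
    with AB have "AE \<omega> in M. \<omega> \<in> A"
      by eventually_elim auto
    then show ?thesis ..
  qed
qed

text \<open>Each event that the slope exceeds c > 0 has probability 0 or 1, and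
  \<open>not_AE_slope_greater\<close> rules out 1; countably many c decreasing to 0 suffice.\<close>

lemma AE_slope_nonpos:
  assumes F: "F \<in> classK M T"
  shows "AE \<omega> in M. slope F z \<omega> \<le> 0"
proof -
  note slope_measurable[OF F, measurable]
  have "AE \<omega> in M. slope F z \<omega> \<le> ereal c" if "c > 0" for c
  proof -
    define A where "A = {\<omega> \<in> space M. slope F z \<omega> > ereal c}"
    have "(AE \<omega> in M. \<omega> \<notin> A) \<or> (AE \<omega> in M. \<omega> \<in> A)"
    proof (rule ergodic_zero_one)
      show "A \<in> sets M"
        unfolding A_def by measurable
      show "AE \<omega> in M. \<forall>x. Tshift T x \<omega> \<in> A \<longleftrightarrow> \<omega> \<in> A"
        using AE_slope_invariant[OF F, of z] AE_space by eventually_elim (simp add: A_def)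
    qed
    then show ?thesis
    proof
      assume "AE \<omega> in M. \<omega> \<notin> A"
      with AE_space show ?thesis
        by eventually_elim (auto simp: A_def not_less)
    next
      assume "AE \<omega> in M. \<omega> \<in> A"
      then have "AE \<omega> in M. slope F z \<omega> > ereal c"
        by eventually_elim (auto simp: A_def)
      with not_AE_slope_greater[OF F that] show ?thesis
        by blast
    qed
  qed
  then have "AE \<omega> in M. \<forall>k. slope F z \<omega> \<le> ereal (inverse (real (Suc k)))"
    by (simp add: AE_all_countable)
  then show ?thesis
  proof eventually_elim
    case (elim \<omega>)
    have "(\<lambda>k. ereal (inverse (real (Suc k)))) \<longlonglongrightarrow> 0"
      using LIMSEQ_inverse_real_of_nat by (simp only: lim_ereal zero_ereal_def)
    from LIMSEQ_le_const[OF this] elim show ?case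
      by blast
  qed
qed

lemma AE_directional_sublinearity:
  assumes F: "F \<in> classK M T"
  shows "AE \<omega> in M. \<forall>z. (\<lambda>n. corrector T F \<omega> (int n *s z) / real n) \<longlonglongrightarrow> 0"
proof -
  have "AE \<omega> in M. (\<lambda>n. corrector T F \<omega> (int n *s z) / real n) \<longlonglongrightarrow> 0" for z
    using AE_slope_nonpos[OF F, of z] AE_slope_nonpos[OF classK_uminus[OF F], of z]
  proof eventually_elim
    case (elim \<omega>)
    show ?case
    proof (rule tendstoI)
      fix \<epsilon> :: real
      assume "\<epsilon> > 0"
      have lt: "\<forall>\<^sub>F n in sequentially. a n < \<epsilon>" if "limsup (\<lambda>n. ereal (a n)) \<le> 0" for a
        using Limsup_lessD[of sequentially "\<lambda>n. ereal (a n)" "ereal \<epsilon>"] that \<open>\<epsilon> > 0\<close>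
        by (simp add: order_le_less_trans)
      show "\<forall>\<^sub>F n in sequentially. dist (corrector T F \<omega> (int n *s z) / real n) 0 < \<epsilon>"
        using lt[OF elim(1)[unfolded slope_def]] lt[OF elim(2)[unfolded slope_def]]
        by eventually_elim (simp add: corrector_uminus dist_real_def abs_less_iff)
    qed
  qed
  then show ?thesis
    by (simp add: AE_all_countable)
qed

theorem AE_corrector_sublinear:
  assumes F: "F \<in> classK M T"
  shows "AE \<omega> in M. \<forall>\<epsilon>>0. \<forall>\<^sub>F n in sequentially. \<forall>x\<in>cube n 0. \<bar>corrector T F \<omega> x\<bar> \<le> \<epsilon> * real n"
proof -
  obtain q where q: "q > real CARD('b)" "\<forall>e\<in>nbrs. integrable M (\<lambda>\<omega>. \<bar>F \<omega> e\<bar> powr q)"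
    using classK_moment[OF F] by metis
  show ?thesis
    using AE_power_sum_cube_averages[OF F q(2)] AE_directional_sublinearity[OF F] classK_AE_closed_form[OF F] AE_space
  proof eventually_elim
    case (elim \<omega>)
    obtain K where K: "K > 0" "\<And>n. (\<Sum>y\<in>cube n 0. power_sum F q (Tshift T y \<omega>)) \<le> K * (2 * real n + 1) ^ CARD('b)"
      using elim(1) by blast
    show ?case
    proof (intro allI impI)
      fix \<epsilon> :: real
      assume "\<epsilon> > 0"
      \<comment> \<open>Half of \<epsilon>, because a radius n is rounded up to a power of 2, which
        is at most 2n.\<close>
      have "\<forall>\<^sub>F N in sequentially. \<forall>x\<in>cube (2 ^ N) 0. \<bar>corrector T F \<omega> x\<bar> \<le> \<epsilon> / 2 * 2 ^ N"
      proof (rule uniformly_sublinear_of_directional[OF q(1)])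
        show "\<bar>corrector T F \<omega> (y + axis i 1) - corrector T F \<omega> y\<bar> powr q \<le> power_sum F q (Tshift T y \<omega>)" for y i
          using corrector_step[OF elim(3) axis_in_nbrs, of y i] by (simp add: power_sum_ge)
        show "(\<lambda>n. corrector T F \<omega> (int n *s z) / real n) \<longlonglongrightarrow> 0" for z
          using elim(2) by blast
      qed (use K \<open>\<epsilon> > 0\<close> in auto)
      then obtain N0 where N0: "\<And>N x. N \<ge> N0 \<Longrightarrow> x \<in> cube (2 ^ N) 0 \<Longrightarrow> \<bar>corrector T F \<omega> x\<bar> \<le> \<epsilon> / 2 * 2 ^ N"
        unfolding eventually_sequentially by blast
      show "\<forall>\<^sub>F n in sequentially. \<forall>x\<in>cube n 0. \<bar>corrector T F \<omega> x\<bar> \<le> \<epsilon> * real n"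
        unfolding eventually_sequentially
      proof (intro exI allI impI ballI)
        fix n and x :: "int^'b"
        assume n: "2 ^ N0 \<le> n" and x: "x \<in> cube n 0"
        have "1 \<le> n"
          using n by (metis One_nat_def Suc_leI order_less_le_trans zero_less_numeral zero_less_power)
        then obtain m where m: "2 ^ m \<le> n" "n < 2 ^ (m + 1)"
          using ex_power_ivl1[of 2 n] by auto
        then have "(2::nat) ^ N0 < 2 ^ (m + 1)"
          using n by linarith
        then have "N0 \<le> m + 1"
          using power_less_imp_less_exp[of "2::nat" N0 "m + 1"] by simp
        moreover have "x \<in> cube (2 ^ (m + 1)) 0"
          using x m(2) cube_mono[of n "2 ^ (m + 1)" 0] by auto
        ultimately have "\<bar>corrector T F \<omega> x\<bar> \<le> \<epsilon> / 2 * 2 ^ (m + 1)"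
          by (rule N0)
        also have "\<dots> = \<epsilon> * real (2 ^ m)"
          by simp
        also have "\<dots> \<le> \<epsilon> * real n"
          using m(1) \<open>\<epsilon> > 0\<close> by (intro mult_left_mono of_nat_mono) auto
        finally show "\<bar>corrector T F \<omega> x\<bar> \<le> \<epsilon> * real n" .
      qed
    qed
  qed
qed

end

section \<open>Moment generating function of the walk\<close>

lemma linner_add: "linner lam (x + y) = linner lam x + linner lam y"
  by (simp add: linner_def distrib_left sum.distrib)

lemma linner_0 [simp]: "linner lam 0 = 0"
  by (simp add: linner_def)

lemma abs_coord_nbr_le_1:
  assumes "e \<in> nbrs"
  shows "\<bar>e $ i\<bar> \<le> 1"
proof -
  have "\<bar>e $ i\<bar> \<le> (\<Sum>j\<in>UNIV. \<bar>e $ j\<bar>)"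
    by (intro member_le_sum) auto
  then show ?thesis
    using assms by (simp add: nbrs_def l1norm_def)
qed

lemma sum_list_nbrs_in_cube:
  assumes "set es \<subseteq> nbrs"
  shows "sum_list es \<in> cube (length es) 0"
proof -
  have "\<bar>sum_list es $ i\<bar> \<le> int (length es)" for i
    using assms
  proof (induction es)
    case (Cons e es)
    then have "\<bar>e $ i\<bar> \<le> 1" "\<bar>sum_list es $ i\<bar> \<le> int (length es)"
      using abs_coord_nbr_le_1 by auto
    then show ?case
      by simp
  qed simp
  then show ?thesis
    by (simp add: cube_def)
qed

text \<open>The environment is frozen in \<pi> and the end-point weight is left free: g =
  \<open>linner lam\<close> gives \<open>walk_mgf\<close>, and adding the corrector gives the sum it
  is compared with.\<close>

definition weighted_walk_sum ::
  "(int^'d::finite \<Rightarrow> int^'d \<Rightarrow> real) \<Rightarrow> (int^'d \<Rightarrow> real) \<Rightarrow> nat \<Rightarrow> real" where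
  "weighted_walk_sum \<pi> g n =
     (\<Sum>es | set es \<subseteq> nbrs \<and> length es = n. (\<Prod>i<n. \<pi> (walkpos es i) (es ! i)) * exp (g (walkpos es n)))"

lemma weighted_walk_sum_0: "weighted_walk_sum \<pi> g 0 = exp (g (0 :: int^'d::finite))"
proof -
  have "{es. set es \<subseteq> nbrs \<and> length es = 0} = {[] :: (int^'d) list}"
    by auto
  then show ?thesis
    unfolding weighted_walk_sum_def by (simp only:) simp
qed

text \<open>Conditioning on the first n steps. The last factor involves only increments of g, which
  for the corrected weight are the exponents in the definition of \<open>LambdaK\<close>.\<close>

lemma weighted_walk_sum_Suc:
  fixes g :: "int^'d::finite \<Rightarrow> real"
  shows "weighted_walk_sum \<pi> g (Suc n) =
     (\<Sum>es | set es \<subseteq> nbrs \<and> length es = n. ((\<Prod>i<n. \<pi> (walkpos es i) (es ! i)) * exp (g (walkpos es n))) *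
        (\<Sum>e\<in>nbrs. \<pi> (walkpos es n) e * exp (g (walkpos es n + e) - g (walkpos es n))))"
proof -
  define P where "P = (\<lambda>n. {es :: (int^'d) list. set es \<subseteq> nbrs \<and> length es = n})"
  define h where "h = (\<lambda>n es. (\<Prod>i<n. \<pi> (walkpos es i) (es ! i)) * exp (g (walkpos es n)))"
  have snoc: "h (Suc n) (es @ [e]) = h n es * (\<pi> (walkpos es n) e * exp (g (walkpos es n + e) - g (walkpos es n)))"
    if "es \<in> P n" for es e
  proof -
    have "walkpos (es @ [e]) i = walkpos es i" if "i \<le> n" for i
      using that \<open>es \<in> P n\<close> by (simp add: walkpos_def P_def)
    moreover have "walkpos (es @ [e]) (Suc n) = walkpos es n + e"
      using \<open>es \<in> P n\<close> by (simp add: walkpos_def P_def)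
    moreover have "length es = n"
      using \<open>es \<in> P n\<close> by (simp add: P_def)
    ultimately show ?thesis
      by (simp add: h_def nth_append exp_diff)
  qed
  have "weighted_walk_sum \<pi> g (Suc n) = (\<Sum>es\<in>P (Suc n). h (Suc n) es)"
    by (simp add: weighted_walk_sum_def P_def h_def)
  also have "\<dots> = (\<Sum>(es, e)\<in>P n \<times> nbrs. h (Suc n) (es @ [e]))"
  proof (rule sum.reindex_bij_witness[of _ "\<lambda>(es, e). es @ [e]" "\<lambda>es. (butlast es, last es)"])
    fix es
    assume "es \<in> P (Suc n)"
    then have "es \<noteq> []" "set es \<subseteq> nbrs" "length es = Suc n"
      by (auto simp: P_def)
    then show "(butlast es, last es) \<in> P n \<times> nbrs" "(case (butlast es, last es) of (es, e) \<Rightarrow> es @ [e]) = es"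
      "(case (butlast es, last es) of (es, e) \<Rightarrow> h (Suc n) (es @ [e])) = h (Suc n) es"
      by (auto simp: P_def dest: in_set_butlastD)
  qed (auto simp: P_def)
  also have "\<dots> = (\<Sum>(es, e)\<in>P n \<times> nbrs. h n es * (\<pi> (walkpos es n) e * exp (g (walkpos es n + e) - g (walkpos es n))))"
    by (rule sum.cong) (auto simp: snoc)
  also have "\<dots> = (\<Sum>es\<in>P n. h n es * (\<Sum>e\<in>nbrs. \<pi> (walkpos es n) e * exp (g (walkpos es n + e) - g (walkpos es n))))"
    by (simp add: sum_distrib_left flip: sum.cartesian_product)
  finally show ?thesis
    by (simp add: P_def h_def)
qed

lemma weighted_walk_sum_le:
  assumes \<pi>: "\<And>x e. e \<in> nbrs \<Longrightarrow> \<pi> x e \<ge> 0"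
    and C: "\<And>x. (\<Sum>e\<in>nbrs. \<pi> x e * exp (g (x + e) - g x)) \<le> C"
  shows "weighted_walk_sum \<pi> g n \<le> C ^ n * exp (g 0)"
proof (induction n)
  case (Suc n)
  have "0 \<le> (\<Sum>e\<in>nbrs. \<pi> 0 e * exp (g (0 + e) - g 0))"
    by (intro sum_nonneg mult_nonneg_nonneg \<pi>) auto
  also have "\<dots> \<le> C"
    by (rule C)
  finally have "C \<ge> 0" .
  have "weighted_walk_sum \<pi> g (Suc n)
      \<le> (\<Sum>es | set es \<subseteq> nbrs \<and> length es = n. ((\<Prod>i<n. \<pi> (walkpos es i) (es ! i)) * exp (g (walkpos es n))) * C)"
    unfolding weighted_walk_sum_Suc
    by (intro sum_mono mult_left_mono C mult_nonneg_nonneg prod_nonneg) (auto intro!: \<pi>)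
  also have "\<dots> = weighted_walk_sum \<pi> g n * C"
    by (simp add: weighted_walk_sum_def sum_distrib_right)
  also have "\<dots> \<le> C ^ n * exp (g 0) * C"
    using Suc.IH \<open>C \<ge> 0\<close> by (rule mult_right_mono)
  finally show ?case
    by (simp add: mult_ac)
qed (simp add: weighted_walk_sum_0)

lemma weighted_walk_sum_pos:
  assumes \<pi>: "\<And>x e. e \<in> nbrs \<Longrightarrow> \<pi> x e \<ge> 0"
    and c: "\<And>x. c \<le> (\<Sum>e\<in>nbrs. \<pi> x e * exp (g (x + e) - g x))" and "c > 0"
  shows "weighted_walk_sum \<pi> g n > 0"
proof (induction n)
  case (Suc n)
  have "0 < weighted_walk_sum \<pi> g n * c"
    using Suc \<open>c > 0\<close> by simp
  also have "\<dots> = (\<Sum>es | set es \<subseteq> nbrs \<and> length es = n. ((\<Prod>i<n. \<pi> (walkpos es i) (es ! i)) * exp (g (walkpos es n))) * c)"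
    by (simp add: weighted_walk_sum_def sum_distrib_right)
  also have "\<dots> \<le> weighted_walk_sum \<pi> g (Suc n)"
    unfolding weighted_walk_sum_Suc
    by (intro sum_mono mult_left_mono c mult_nonneg_nonneg prod_nonneg) (auto intro!: \<pi>)
  finally show ?case .
qed (simp add: weighted_walk_sum_0)

text \<open>The weight is evaluated only at the end point, which n steps cannot take outside the
  cube of radius n.\<close>

lemma weighted_walk_sum_perturb:
  assumes \<pi>: "\<And>x e. e \<in> nbrs \<Longrightarrow> \<pi> x e \<ge> 0"
    and b: "\<And>x. x \<in> cube n 0 \<Longrightarrow> g x \<le> g' x + b"
  shows "weighted_walk_sum \<pi> g n \<le> weighted_walk_sum \<pi> g' n * exp b"
proof -
  have "walkpos es n \<in> cube n 0" if "set es \<subseteq> nbrs" "length es = n" for es :: "(int^'a) list"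
    using sum_list_nbrs_in_cube[of es] that by (simp add: walkpos_def)
  then show ?thesis
    unfolding weighted_walk_sum_def sum_distrib_right mult.assoc
    by (intro sum_mono mult_left_mono prod_nonneg) (auto simp: b intro!: \<pi> simp flip: exp_add)
qed

locale random_environment = ergodic_lattice_action M T
  for M :: "'w measure" and T :: "int^'d::finite \<Rightarrow> 'w \<Rightarrow> 'w" +
  fixes p :: "'w \<Rightarrow> int^'d \<Rightarrow> real"
  assumes p_range: "\<And>\<omega> e. \<omega> \<in> space M \<Longrightarrow> e \<in> nbrs \<Longrightarrow> 0 \<le> p \<omega> e \<and> p \<omega> e \<le> 1"
    and p_sum: "\<And>\<omega>. \<omega> \<in> space M \<Longrightarrow> (\<Sum>e\<in>nbrs. p \<omega> e) = 1"
begin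

lemma walk_mgf_eq: "walk_mgf T p lam n \<omega> = weighted_walk_sum (\<lambda>x. p (Tshift T x \<omega>)) (linner lam) n"
  by (simp add: walk_mgf_def weighted_walk_sum_def)

text \<open>Positivity is essential for monotonicity of the logarithm, since \<open>ln 0 = 0\<close>.\<close>
lemma walk_mgf_pos:
  assumes \<omega>: "\<omega> \<in> space M"
  shows "walk_mgf T p lam n \<omega> > 0"
proof -
  \<comment> \<open>The transition probabilities sum to 1, so every tilted one-step sum is at least
    the smallest tilt.\<close>
  define c where "c = Min ((\<lambda>e. exp (linner lam e)) ` nbrs)"
  have c: "c \<le> exp (linner lam e)" if "e \<in> nbrs" for e
    using that by (simp add: c_def)
  have "c > 0"
    unfolding c_def using nbrs_nonempty by (subst Min_gr_iff) auto
  have "c \<le> (\<Sum>e\<in>nbrs. p (Tshift T x \<omega>) e * exp (linner lam (x + e) - linner lam x))" for x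
  proof -
    have "c = (\<Sum>e\<in>nbrs. p (Tshift T x \<omega>) e * c)"
      using p_sum[of "Tshift T x \<omega>"] \<omega> by (simp flip: sum_distrib_right)
    also have "\<dots> \<le> (\<Sum>e\<in>nbrs. p (Tshift T x \<omega>) e * exp (linner lam (x + e) - linner lam x))"
      using p_range \<omega> c by (intro sum_mono mult_left_mono) (auto simp: linner_add)
    finally show ?thesis .
  qed
  then show ?thesis
    unfolding walk_mgf_eq using p_range \<omega> \<open>c > 0\<close> by (intro weighted_walk_sum_pos[of _ c]) auto
qed

lemma AE_limsup_le_esssup:
  assumes F: "F \<in> classK M T"
  shows "AE \<omega> in M. limsup (\<lambda>n. ereal (ln (walk_mgf T p lam n \<omega>) / real n))
    \<le> esssup M (\<lambda>\<omega>. ereal (ln (\<Sum>e\<in>nbrs. p \<omega> e * exp (linner lam e + F \<omega> e))))"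
    (is "AE \<omega> in M. ?L \<omega> \<le> ?E")
proof (cases ?E)
  case (real r)
  have "AE \<omega> in M. ereal (ln (\<Sum>e\<in>nbrs. p \<omega> e * exp (linner lam e + F \<omega> e))) \<le> ereal r"
    unfolding real[symmetric] by (rule esssup_AE)
  then have "AE \<omega> in M. (\<Sum>e\<in>nbrs. p \<omega> e * exp (linner lam e + F \<omega> e)) \<le> exp r"
  proof eventually_elim
    case (elim \<omega>)
    define S where "S = (\<Sum>e\<in>nbrs. p \<omega> e * exp (linner lam e + F \<omega> e))"
    show ?case
    proof (cases "S > 0")
      case True
      have "ln S \<le> r"
        using elim by (simp add: S_def)
      then have "exp (ln S) \<le> exp r"
        by simp
      then have "S \<le> exp r"
        using True by (simp only: exp_ln)
      then show ?thesis
        by (simp add: S_def)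
    next
      \<comment> \<open>For S \<le> 0 the bound on \<open>ln S\<close> says nothing about S, but
        then S is below \<open>exp r\<close> trivially.\<close>
      case False
      then have "S \<le> exp r"
        by (meson exp_ge_zero not_less order_trans)
      then show ?thesis
        by (simp add: S_def)
    qed
  qed
  \<comment> \<open>The walk may visit any site, so the one-step bound is needed at all of them for
    the same \<omega>.\<close>
  from AE_all_Tshift[OF this] show ?thesis
    using AE_corrector_sublinear[OF F] classK_AE_closed_form[OF F] AE_space
  proof eventually_elim
    case (elim \<omega>)
    define f where "f = corrector T F \<omega>"
    define \<pi> where "\<pi> = (\<lambda>x. p (Tshift T x \<omega>))"
    define g where "g = (\<lambda>x. linner lam x + f x)"
    have \<pi>: "\<pi> x e \<ge> 0" if "e \<in> nbrs" for x e
      using p_range elim(4) that by (simp add: \<pi>_def)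
    have g: "(\<Sum>e\<in>nbrs. \<pi> x e * exp (g (x + e) - g x)) \<le> exp r" for x
    proof -
      have "g (x + e) - g x = linner lam e + F (Tshift T x \<omega>) e" if "e \<in> nbrs" for e
        using corrector_step[OF elim(3) that] by (simp add: g_def f_def linner_add)
      then have "(\<Sum>e\<in>nbrs. \<pi> x e * exp (g (x + e) - g x))
          = (\<Sum>e\<in>nbrs. p (Tshift T x \<omega>) e * exp (linner lam e + F (Tshift T x \<omega>) e))"
        unfolding \<pi>_def by (intro sum.cong) simp_all
      then show ?thesis
        using elim(1) by simp
    qed
    have "?L \<omega> \<le> ereal (r + \<epsilon>)" if "\<epsilon> > 0" for \<epsilon>
    proof (rule Limsup_bounded)
      have "\<forall>\<^sub>F n in sequentially. \<forall>x\<in>cube n 0. \<bar>f x\<bar> \<le> \<epsilon> * real n"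
        using elim(2) that by (simp add: f_def)
      with eventually_gt_at_top[of 0]
      show "\<forall>\<^sub>F n in sequentially. ereal (ln (walk_mgf T p lam n \<omega>) / real n) \<le> ereal (r + \<epsilon>)"
      proof eventually_elim
        case (elim n)
        have "walk_mgf T p lam n \<omega> \<le> weighted_walk_sum \<pi> g n * exp (\<epsilon> * real n)"
          unfolding walk_mgf_eq \<pi>_def[symmetric]
        proof (rule weighted_walk_sum_perturb)
          show "linner lam x \<le> g x + \<epsilon> * real n" if "x \<in> cube n 0" for x
            using bspec[OF elim(2) that] unfolding g_def by linarith
        qed (rule \<pi>)
        also have "\<dots> \<le> exp r ^ n * exp (g 0) * exp (\<epsilon> * real n)"
          by (intro mult_right_mono weighted_walk_sum_le \<pi> g) auto
        also have "\<dots> = exp ((r + \<epsilon>) * real n)"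
          using corrector_0[OF \<open>closed_form T F \<omega>\<close>]
          by (simp add: g_def f_def distrib_right exp_add mult.commute[of r] flip: exp_of_nat_mult)
        finally have "ln (walk_mgf T p lam n \<omega>) \<le> ln (exp ((r + \<epsilon>) * real n))"
          using walk_mgf_pos[OF \<open>\<omega> \<in> space M\<close>] by (intro ln_mono) auto
        then show ?case
          using elim(1) by (simp add: field_simps)
      qed
    qed
    then have "?L \<omega> \<le> ereal r + ereal \<epsilon>" if "\<epsilon> > 0" for \<epsilon>
      using that by (simp only: plus_ereal.simps)
    then have "?L \<omega> \<le> ereal r"
      by (rule ereal_le_epsilon2)
    then show ?case
      by (simp add: real)
  qed
next
  case MInf
  have "AE \<omega> in M. ereal (ln (\<Sum>e\<in>nbrs. p \<omega> e * exp (linner lam e + F \<omega> e))) \<le> - \<infinity>"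
    unfolding MInf[symmetric] by (rule esssup_AE)
  \<comment> \<open>A real number is never at most -\<infinity>, so the premise is contradictory at
    every point where it holds.\<close>
  then show ?thesis
    by eventually_elim simp
qed simp

text \<open>The exceptional null set depends on F and the class is uncountable, so the infimum is
  first written as the infimum of a sequence of its values.\<close>

lemma AE_limsup_le_LambdaK:
  "AE \<omega> in M. limsup (\<lambda>n. ereal (ln (walk_mgf T p lam n \<omega>) / real n)) \<le> LambdaK M T p lam"
proof -
  define Q where "Q = (\<lambda>F. esssup M (\<lambda>\<omega>. ereal (ln (\<Sum>e\<in>nbrs. p \<omega> e * exp (linner lam e + F \<omega> e)))))"
  show ?thesis
  proof (cases "classK M T = {}")
    case False
    then obtain a :: "nat \<Rightarrow> ereal" where a: "range a \<subseteq> Q ` classK M T" "Inf (Q ` classK M T) = (INF i. a i)"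
      using Inf_countable_INF[of "Q ` classK M T"] by auto
    have "AE \<omega> in M. limsup (\<lambda>n. ereal (ln (walk_mgf T p lam n \<omega>) / real n)) \<le> a i" for i
    proof -
      obtain F where "F \<in> classK M T" "a i = Q F"
        using a(1) by blast
      then show ?thesis
        using AE_limsup_le_esssup by (simp add: Q_def)
    qed
    then have "AE \<omega> in M. \<forall>i. limsup (\<lambda>n. ereal (ln (walk_mgf T p lam n \<omega>) / real n)) \<le> a i"
      by (simp add: AE_all_countable)
    then show ?thesis
    proof eventually_elim
      case (elim \<omega>)
      then show ?case
        using a(2) by (simp add: LambdaK_def Q_def[abs_def] le_INF_iff)
    qed
  qed (simp add: LambdaK_def top_ereal_def)
qed

end

theorem theorem3p3:
  fixes M :: "'w measure" and T :: "int^'d::finite \<Rightarrow> 'w \<Rightarrow> 'w"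
    and p :: "'w \<Rightarrow> int^'d \<Rightarrow> real" and lam :: "real^'d"
  assumes "prob_space M"
    and T_meas: "\<And>e. e \<in> nbrs \<Longrightarrow> T e \<in> M \<rightarrow>\<^sub>M M"
    and T_pres: "\<And>e. e \<in> nbrs \<Longrightarrow> distr M M (T e) = M"
    and T_comm: "\<And>e e' \<omega>. e \<in> nbrs \<Longrightarrow> e' \<in> nbrs \<Longrightarrow> \<omega> \<in> space M \<Longrightarrow>
                   T e (T e' \<omega>) = T e' (T e \<omega>)"
    and T_inv: "\<And>e \<omega>. e \<in> nbrs \<Longrightarrow> \<omega> \<in> space M \<Longrightarrow> T (- e) (T e \<omega>) = \<omega>"
    and ergodic: "\<And>A. A \<in> sets M \<Longrightarrow> (\<forall>e\<in>nbrs. T e -` A \<inter> space M = A) \<Longrightarrow>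
                   measure M A = 0 \<or> measure M A = 1"
    and p_meas: "\<And>e. e \<in> nbrs \<Longrightarrow> (\<lambda>\<omega>. p \<omega> e) \<in> borel_measurable M"
    and p_range: "\<And>\<omega> e. \<omega> \<in> space M \<Longrightarrow> e \<in> nbrs \<Longrightarrow> 0 \<le> p \<omega> e \<and> p \<omega> e \<le> 1"
    and p_sum: "\<And>\<omega>. \<omega> \<in> space M \<Longrightarrow> (\<Sum>e\<in>nbrs. p \<omega> e) = 1"
  shows "AE \<omega> in M. limsup (\<lambda>n. ereal (ln (walk_mgf T p lam n \<omega>) / real n))
                     \<le> LambdaK M T p lam"
proof -
  interpret prob_space M by fact
  interpret random_environment M T p
    by unfold_locales (fact T_meas T_pres T_comm T_inv ergodic p_range p_sum)+
  show ?thesis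
    by (rule AE_limsup_le_LambdaK)
qed

end
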